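(* Let $H$ be a complex Hilbert space and let $T\in\mathcal{B}(H)$. If $T$ is co-hyponormal and binormal, then its mean transform $M(T)$ is co-hyponormal.
   Context: $\mathcal{B}(H)$ is the algebra of bounded linear operators on $H$. For $T\in\mathcal{B}(H)$, $|T|=(T^*T)^{1/2}$, and the polar decomposition $T=V|T|$ is the canonical one: $V$ is the unique partial isometry with $T=V|T|$ and $\ker(V)=\ker(T)$. The mean transform of $T$ is $M(T)=\frac12(T+|T|V)$. An operator $A\in\mathcal{B}(H)$ is co-hyponormal if $A^*A\leq AA^*$, and binormal if $A^*A$ and $AA^*$ commute. *)

theory Defs
  imports "HOL-Analysis.Analysis"
begin

text \<open>
  A complex inner product space is presented on top of the class \<^class>\<open>real_inner\<close>: the real
  inner product is the real part of the complex one.  Hence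
  \<open>norm x = sqrt (Re (cinner x x))\<close>, and norm, topology and completeness are those of the library.
  Positive definiteness of \<open>cinner\<close> is inherited from the real inner product.
  The form \<open>cinner\<close> is linear in its first argument.
\<close>

class complex_inner = real_inner +
  fixes scaleC :: "complex \<Rightarrow> 'a \<Rightarrow> 'a" (infixr "*\<^sub>C" 75)
    and cinner :: "'a \<Rightarrow> 'a \<Rightarrow> complex"
  assumes scaleC_add_right: "c *\<^sub>C (x + y) = c *\<^sub>C x + c *\<^sub>C y"
    and scaleC_add_left: "(c + d) *\<^sub>C x = c *\<^sub>C x + d *\<^sub>C x"
    and scaleC_scaleC: "c *\<^sub>C d *\<^sub>C x = (c * d) *\<^sub>C x"
    and scaleC_of_real: "complex_of_real r *\<^sub>C x = r *\<^sub>R x"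
    and cinner_commute: "cinner x y = cnj (cinner y x)"
    and cinner_add_left: "cinner (x + y) z = cinner x z + cinner y z"
    and cinner_scaleC_left: "cinner (c *\<^sub>C x) y = c * cinner x y"
    and Re_cinner: "Re (cinner x y) = inner x y"

class complex_hilbert_space = complex_inner + complete_space

instantiation complex :: complex_hilbert_space
begin

definition scaleC_complex :: "complex \<Rightarrow> complex \<Rightarrow> complex" where
  "scaleC_complex c x = c * x"

definition cinner_complex :: "complex \<Rightarrow> complex \<Rightarrow> complex" where
  "cinner_complex x y = x * cnj y"

instance
  by standard
    (simp_all add: scaleC_complex_def cinner_complex_def inner_complex_def
      scaleR_conv_of_real algebra_simps)

end

lemma cinner_self: "cinner x x = complex_of_real ((norm x)\<^sup>2)"
  for x :: "'a::complex_inner"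
proof -
  have "Im (cinner x x) = 0"
    using cinner_commute[of x x] by (metis cnj.sel(2) neg_equal_zero)
  then show ?thesis
    by (simp add: complex_eq_iff Re_cinner power2_norm_eq_inner)
qed

text \<open>Elements of \<open>\<B>(H)\<close> are represented by functions satisfying \<open>bounded_clinear\<close>.\<close>

definition bounded_clinear :: "('a::complex_inner \<Rightarrow> 'a) \<Rightarrow> bool" where
  "bounded_clinear T \<longleftrightarrow> bounded_linear T \<and> (\<forall>c x. T (c *\<^sub>C x) = c *\<^sub>C T x)"

definition op_adj :: "('a::complex_hilbert_space \<Rightarrow> 'a) \<Rightarrow> 'a \<Rightarrow> 'a" where
  "op_adj T = (THE S. bounded_clinear S \<and> (\<forall>x y. cinner (T x) y = cinner x (S y)))"

definition op_positive :: "('a::complex_inner \<Rightarrow> 'a) \<Rightarrow> bool" where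
  "op_positive A \<longleftrightarrow> (\<forall>x. cinner (A x) x \<in> \<real>\<^sub>\<ge>\<^sub>0)"

definition op_le :: "('a::complex_inner \<Rightarrow> 'a) \<Rightarrow> ('a \<Rightarrow> 'a) \<Rightarrow> bool" where
  "op_le A B \<longleftrightarrow> op_positive (\<lambda>x. B x - A x)"

definition op_sqrt :: "('a::complex_hilbert_space \<Rightarrow> 'a) \<Rightarrow> 'a \<Rightarrow> 'a" where
  "op_sqrt A = (THE S. bounded_clinear S \<and> op_positive S \<and> S \<circ> S = A)"

definition op_abs :: "('a::complex_hilbert_space \<Rightarrow> 'a) \<Rightarrow> 'a \<Rightarrow> 'a" where
  "op_abs T = op_sqrt (op_adj T \<circ> T)"

definition op_ker :: "('a::complex_inner \<Rightarrow> 'a) \<Rightarrow> 'a set" where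
  "op_ker T = {x. T x = 0}"

text \<open>A partial isometry is isometric on the orthogonal complement of its kernel.\<close>

definition partial_isometry :: "('a::complex_inner \<Rightarrow> 'a) \<Rightarrow> bool" where
  "partial_isometry V \<longleftrightarrow> bounded_clinear V \<and>
     (\<forall>x. (\<forall>y \<in> op_ker V. cinner x y = 0) \<longrightarrow> norm (V x) = norm x)"

definition polar_factor :: "('a::complex_hilbert_space \<Rightarrow> 'a) \<Rightarrow> 'a \<Rightarrow> 'a" where
  "polar_factor T =
     (THE V. partial_isometry V \<and> T = V \<circ> op_abs T \<and> op_ker V = op_ker T)"

definition mean_transform :: "('a::complex_hilbert_space \<Rightarrow> 'a) \<Rightarrow> 'a \<Rightarrow> 'a" where
  "mean_transform T = (\<lambda>x. (1/2) *\<^sub>R (T x + op_abs T (polar_factor T x)))"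

definition co_hyponormal :: "('a::complex_hilbert_space \<Rightarrow> 'a) \<Rightarrow> bool" where
  "co_hyponormal A \<longleftrightarrow> bounded_clinear A \<and> op_le (op_adj A \<circ> A) (A \<circ> op_adj A)"

definition binormal :: "('a::complex_hilbert_space \<Rightarrow> 'a) \<Rightarrow> bool" where
  "binormal A \<longleftrightarrow> bounded_clinear A \<and>
     (op_adj A \<circ> A) \<circ> (A \<circ> op_adj A) = (A \<circ> op_adj A) \<circ> (op_adj A \<circ> A)"

end

theory Submission
  imports Defs
begin

text \<open>
  Write \<open>A = |T|\<close>, \<open>T = V A\<close> for the polar decomposition, \<open>W = V*\<close> and \<open>B = V A W\<close>.  Then
  \<open>B\<close> is positive with \<open>B B = T T*\<close>, so \<open>B = |T*|\<close>.  Co-hyponormality of an operator \<open>S\<close> means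
  \<open>norm (S x) \<le> norm (S* x)\<close> for all \<open>x\<close>; for \<open>T\<close> it says \<open>norm (A x) \<le> norm (B x)\<close>, and it
  forces \<open>ker T* \<subseteq> ker T\<close>, so that besides \<open>W V A = A\<close> also \<open>V W A = A\<close> holds.  The theorem
  follows by comparing both sides with \<open>norm (T x)\<close>.

  Upper bound: \<open>2 M(T) = T + A V\<close>, where \<open>norm (A V x) = norm (T V x) \<le> norm (T* V x)\<close>, and
  \<open>T* V = A W V = A\<close>.  Hence \<open>norm (M(T) x) \<le> norm (T x)\<close>.

  Lower bound: \<open>2 M(T)* = A W + W A = W (A + B)\<close>, and \<open>V\<close>, a contraction, maps \<open>W (A + B) x\<close> back to
  \<open>(A + B) x\<close>.  So it suffices that \<open>norm ((A + B) x) \<ge> 2 norm (A x)\<close>, which comes from expanding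
  the square once \<open>Re <A x, B x> \<ge> norm (A x)^2\<close> is known, that is, once \<open>A (B - A) \<ge> 0\<close>.
  Here binormality enters: \<open>A\<close> and \<open>B\<close> are the roots of the commuting operators \<open>T* T\<close> and
  \<open>T T*\<close>, hence commute.  For commuting positive operators \<open>norm (A x) \<le> norm (B x)\<close> gives
  \<open>A \<le> B\<close>, and the product of the commuting positive operators \<open>A\<close> and \<open>B - A\<close> is positive.

  The Hilbert space theory behind this is developed for the real inner product:
  orthogonal projections, the Riesz theorem and adjoints; the positive square root of a positive
  operator, from the binomial series of \<open>sqrt (1 - x)\<close>; and the polar decomposition.  Roots and
  polar factors obtained in this way are complex linear because whatever commutes with the given
  operators commutes with them, in particular multiplication by \<open>\<i>\<close>.
\<close>

section \<open>Orthogonal projections and the Riesz theorem\<close>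

instance complex_hilbert_space \<subseteq> banach ..

lemma parallelogram_midpoint:
  fixes u v x :: "'a::real_inner"
  shows "(norm (u - v))\<^sup>2 =
    2 * (norm (x - u))\<^sup>2 + 2 * (norm (x - v))\<^sup>2 - 4 * (norm (x - (1/2) *\<^sub>R (u + v)))\<^sup>2"
  by (simp add: power2_norm_eq_inner inner_diff inner_add inner_commute algebra_simps)

text \<open>
  By the parallelogram law, points of \<open>M\<close> whose squared distance to \<open>x\<close> is within \<open>1/(N+1)\<close> of the
  infimum lie close to each other, so a minimizing sequence is Cauchy.  At the limit no direction
  in \<open>M\<close> decreases the distance, which is orthogonality.
\<close>

lemma orthogonal_projection_exists:
  fixes M :: "'a::{real_inner,banach} set"
  assumes "subspace M" and "closed M"
  obtains u where "u \<in> M" and "\<And>y. y \<in> M \<Longrightarrow> inner (x - u) y = 0"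
proof -
  define d where "d = (INF u\<in>M. (norm (x - u))\<^sup>2)"
  have ne: "M \<noteq> {}" using assms(1) subspace_0 by auto
  have bdd: "bdd_below ((\<lambda>u. (norm (x - u))\<^sup>2) ` M)" by (rule bdd_belowI2[of _ 0]) simp
  have d_le: "d \<le> (norm (x - u))\<^sup>2" if "u \<in> M" for u
    unfolding d_def by (rule cINF_lower[OF bdd that])
  have "\<exists>u\<in>M. (norm (x - u))\<^sup>2 < d + inverse (real (Suc n))" for n
    using cINF_less_iff[OF ne bdd, of "d + inverse (real (Suc n))"] unfolding d_def by simp
  then obtain s where sM: "\<And>n. s n \<in> M"
    and s_less: "\<And>n. (norm (x - s n))\<^sup>2 < d + inverse (real (Suc n))"
    by metis
  have dist: "(norm (s m - s n))\<^sup>2 \<le> 4 * inverse (real (Suc N))" if "m \<ge> N" "n \<ge> N" for m n N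
  proof -
    have "(1/2) *\<^sub>R (s m + s n) \<in> M"
      by (intro subspace_scale subspace_add assms sM)
    from d_le[OF this]
    have "(norm (s m - s n))\<^sup>2 \<le> 2 * (norm (x - s m))\<^sup>2 + 2 * (norm (x - s n))\<^sup>2 - 4 * d"
      by (subst parallelogram_midpoint[where x = x]) simp
    moreover have "inverse (real (Suc m)) \<le> inverse (real (Suc N))"
      "inverse (real (Suc n)) \<le> inverse (real (Suc N))"
      using that by (auto simp: field_simps)
    ultimately show ?thesis using s_less[of m] s_less[of n] by linarith
  qed
  have "Cauchy s"
  proof (rule metric_CauchyI)
    fix e :: real assume "e > 0"
    then have "e\<^sup>2 / 4 > 0" by simp
    then obtain N where N: "inverse (real (Suc N)) < e\<^sup>2 / 4" using reals_Archimedean by blast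
    have "dist (s m) (s n) < e" if "m \<ge> N" "n \<ge> N" for m n
    proof -
      have "(norm (s m - s n))\<^sup>2 < e\<^sup>2" using dist[OF that] N by linarith
      then show ?thesis using \<open>e > 0\<close> by (simp add: dist_norm power2_less_imp_less)
    qed
    then show "\<exists>N. \<forall>m\<ge>N. \<forall>n\<ge>N. dist (s m) (s n) < e" by blast
  qed
  then obtain u where u: "s \<longlonglongrightarrow> u" using Cauchy_convergent convergent_def by blast
  have uM: "u \<in> M" using closed_sequentially[OF assms(2) _ u] sM by blast
  have "(norm (x - u))\<^sup>2 \<le> d"
  proof (rule LIMSEQ_le)
    show "(\<lambda>n. (norm (x - s n))\<^sup>2) \<longlonglongrightarrow> (norm (x - u))\<^sup>2" by (intro tendsto_intros u)
    show "(\<lambda>n. d + inverse (real (Suc n))) \<longlonglongrightarrow> d"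
      using tendsto_add[OF tendsto_const LIMSEQ_inverse_real_of_nat, of d] by simp
    show "\<exists>N. \<forall>n\<ge>N. (norm (x - s n))\<^sup>2 \<le> d + inverse (real (Suc n))"
      using s_less less_imp_le by blast
  qed
  have "inner (x - u) y = 0" if y: "y \<in> M" for y
  proof (cases "y = 0")
    case False
    \<comment> \<open>The minimizer of the quadratic in \<open>t\<close> that gives the distance from \<open>x\<close> to \<open>u + t y\<close>.\<close>
    define t where "t = inner (x - u) y / (norm y)\<^sup>2"
    have "u + t *\<^sub>R y \<in> M" by (intro subspace_add subspace_scale assms uM y)
    from d_le[OF this] have "(norm (x - u))\<^sup>2 \<le> (norm (x - (u + t *\<^sub>R y)))\<^sup>2"
      using \<open>(norm (x - u))\<^sup>2 \<le> d\<close> by linarith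
    also have "\<dots> = (norm (x - u))\<^sup>2 - 2 * t * inner (x - u) y + t\<^sup>2 * (norm y)\<^sup>2"
      unfolding power2_norm_eq_inner
      by (simp add: inner_diff inner_add inner_commute algebra_simps power2_eq_square)
    also have "\<dots> = (norm (x - u))\<^sup>2 - (inner (x - u) y)\<^sup>2 / (norm y)\<^sup>2"
      using False by (simp add: t_def field_simps power2_eq_square)
    finally have "(inner (x - u) y)\<^sup>2 / (norm y)\<^sup>2 \<le> 0" by simp
    then show ?thesis using False by (simp add: divide_le_0_iff)
  qed simp
  then show thesis using uM that by blast
qed

lemma subspace_kernel_bounded_linear:
  assumes "bounded_linear f"
  shows "subspace {x. f x = 0}" and "closed {x. f x = 0}"
proof -
  interpret bounded_linear f by fact
  show "subspace {x. f x = 0}" by (auto simp: subspace_def zero add scaleR)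
  have "continuous_on UNIV f" by (simp add: linear_continuous_on assms)
  then show "closed {x. f x = 0}" by (intro closed_Collect_eq continuous_on_const)
qed

text \<open>
  A nonzero functional is determined by its value on a vector \<open>w\<close> orthogonal to its kernel: every
  \<open>x\<close> differs from a multiple of \<open>w\<close> by an element of the kernel.
\<close>

lemma Riesz_representation:
  fixes f :: "'a::{real_inner,banach} \<Rightarrow> real"
  assumes "bounded_linear f"
  obtains z where "\<And>x. f x = inner x z"
proof (cases "\<forall>x. f x = 0")
  case True
  then show thesis by (intro that[of 0]) simp
next
  case False
  interpret bounded_linear f by fact
  from False obtain x0 where x0: "f x0 \<noteq> 0" by blast
  obtain u where "u \<in> {x. f x = 0}"
    and "\<And>y. y \<in> {x. f x = 0} \<Longrightarrow> inner (x0 - u) y = 0"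
    using orthogonal_projection_exists[OF subspace_kernel_bounded_linear[OF assms], of x0] by blast
  then have u: "f u = 0" "\<And>y. f y = 0 \<Longrightarrow> inner (x0 - u) y = 0" by simp_all
  define w where "w = x0 - u"
  have fw: "f w \<noteq> 0" using x0 u by (simp add: w_def diff)
  then have "w \<noteq> 0" using zero by auto
  show thesis
  proof (rule that[of "(f w / (norm w)\<^sup>2) *\<^sub>R w"])
    fix x
    have "f (x - (f x / f w) *\<^sub>R w) = 0" using fw by (simp add: diff scaleR)
    then have "inner w (x - (f x / f w) *\<^sub>R w) = 0" using u(2) by (simp add: w_def)
    then have "inner x w = (f x / f w) * (norm w)\<^sup>2"
      by (simp add: inner_diff inner_commute power2_norm_eq_inner)
    then show "f x = inner x ((f w / (norm w)\<^sup>2) *\<^sub>R w)"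
      using fw \<open>w \<noteq> 0\<close> by (simp add: field_simps)
  qed
qed

section \<open>Adjoints\<close>

text \<open>
  A relation instead of a choice of adjoint: symmetry and composition are then immediate, and
  self-adjointness is \<open>adj_pair A A\<close>.
\<close>

definition adj_pair :: "('a::real_inner \<Rightarrow> 'b::real_inner) \<Rightarrow> ('b \<Rightarrow> 'a) \<Rightarrow> bool" where
  "adj_pair T S \<longleftrightarrow> (\<forall>x y. inner (T x) y = inner x (S y))"

lemma adj_pairD: "adj_pair T S \<Longrightarrow> inner (T x) y = inner x (S y)"
  by (simp add: adj_pair_def)

lemma adj_pair_sym: "adj_pair T S \<Longrightarrow> adj_pair S T"
  by (metis adj_pair_def inner_commute)

lemma adj_pair_comp: "adj_pair T T' \<Longrightarrow> adj_pair S S' \<Longrightarrow> adj_pair (T \<circ> S) (S' \<circ> T')"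
  by (simp add: adj_pair_def)

lemma adj_pair_unique:
  assumes "adj_pair T S" and "adj_pair T S'"
  shows "S = S'"
proof
  fix y
  have "inner x (S y) = inner x (S' y)" for x using assms by (metis adj_pair_def)
  then show "S y = S' y" by (metis vector_eq_ldot)
qed

lemma adj_pair_bounded_linear:
  assumes T: "bounded_linear T" and "adj_pair T S"
  shows "bounded_linear S"
proof -
  note adjD = adj_pairD[OF assms(2)] and adj = adj_pairD[OF assms(2), symmetric]
  obtain K where K: "K \<ge> 0" "\<And>x. norm (T x) \<le> norm x * K" 
    using T bounded_linear.nonneg_bounded by blast
  show ?thesis
  proof (rule bounded_linear_intro[where K = K])
    fix x y :: 'b and r :: real
    show "S (x + y) = S x + S y"
      by (subst vector_eq_ldot[symmetric]) (simp add: adj inner_add_right)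
    show "S (r *\<^sub>R x) = r *\<^sub>R S x"
      by (subst vector_eq_ldot[symmetric]) (simp add: adj)
    have "norm (S x) * norm (S x) = inner (T (S x)) x"
      by (simp add: adjD dot_square_norm power2_eq_square)
    also have "\<dots> \<le> norm (T (S x)) * norm x" by (rule norm_cauchy_schwarz)
    also have "\<dots> \<le> (norm (S x) * K) * norm x" by (intro mult_right_mono K) simp
    finally have "norm (S x) * norm (S x) \<le> norm (S x) * (norm x * K)" by (simp add: ac_simps)
    then show "norm (S x) \<le> norm x * K"
      using K(1) by (cases "S x = 0") auto
  qed
qed

lemma adj_pair_exists:
  fixes T :: "'a::{real_inner,banach} \<Rightarrow> 'b::real_inner"
  assumes "bounded_linear T"
  obtains S where "adj_pair T S" "bounded_linear S"
proof -
  have "\<exists>z. \<forall>x. inner (T x) y = inner x z" for y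
  proof -
    have "bounded_linear (\<lambda>x. inner (T x) y)"
      using bounded_linear_compose[OF bounded_linear_inner_left assms] .
    from Riesz_representation[OF this] show ?thesis by metis
  qed
  then obtain S where "\<And>x y. inner (T x) y = inner x (S y)" by metis
  then have "adj_pair T S" by (simp add: adj_pair_def)
  then show thesis using that adj_pair_bounded_linear[OF assms] by blast
qed

lemma norm_adjoint_le:
  assumes "adj_pair T S" and "\<And>x. norm (T x) \<le> norm x"
  shows "norm (S y) \<le> norm y"
proof -
  have "norm (S y) * norm (S y) = inner (T (S y)) y"
    unfolding adj_pairD[OF assms(1)] dot_square_norm power2_eq_square ..
  also have "\<dots> \<le> norm (T (S y)) * norm y" by (rule norm_cauchy_schwarz)
  also have "\<dots> \<le> norm (S y) * norm y" by (intro mult_right_mono assms) simp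
  finally show ?thesis by (cases "S y = 0") auto
qed

text \<open>
  Expanding the square gives
  \<open>norm (W V w - w)^2 = norm (W V w)^2 - 2 norm (V w)^2 + norm w^2 \<le> norm w^2 - norm (V w)^2\<close>.
  For a partial isometry it says that \<open>V* V\<close> fixes the initial space.
\<close>

lemma contraction_adjoint_inverts:
  assumes "adj_pair V W" and "\<And>x. norm (V x) \<le> norm x" and w: "norm (V w) = norm w"
  shows "W (V w) = w"
proof -
  have "norm (W (V w)) \<le> norm (V w)" by (rule norm_adjoint_le[OF assms(1,2)])
  then have "(norm (W (V w)))\<^sup>2 \<le> (norm (V w))\<^sup>2" by simp
  moreover have "inner w (W (V w)) = (norm (V w))\<^sup>2"
    unfolding adj_pairD[OF assms(1), symmetric] dot_square_norm ..
  ultimately have "(norm (W (V w) - w))\<^sup>2 \<le> 0"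
    using w by (simp add: power2_norm_eq_inner inner_diff inner_commute)
  then show ?thesis by simp
qed


section \<open>Complex linearity and the real inner product\<close>

lemma cinner_eq_inner:
  fixes x y :: "'a::complex_inner"
  shows "cinner x y = Complex (inner x y) (inner (- \<i> *\<^sub>C x) y)"
  by (simp add: complex_eq_iff Re_cinner[symmetric] cinner_scaleC_left)

text \<open>
  Skew-adjointness of multiplication by \<open>\<i>\<close> for the real inner product: it makes real adjoints of
  complex linear operators complex linear.
\<close>

lemma inner_scaleC_ii:
  fixes x y :: "'a::complex_inner"
  shows "inner (\<i> *\<^sub>C x) y = - inner x (\<i> *\<^sub>C y)"
proof -
  have "cinner x (\<i> *\<^sub>C y) = cnj \<i> * cinner x y"
    by (metis cinner_commute cinner_scaleC_left complex_cnj_mult)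
  then show ?thesis by (simp flip: Re_cinner add: cinner_scaleC_left)
qed

lemma bounded_clinear_iff:
  fixes T :: "'a::complex_inner \<Rightarrow> 'a"
  shows "bounded_clinear T \<longleftrightarrow> bounded_linear T \<and> (\<forall>x. T (\<i> *\<^sub>C x) = \<i> *\<^sub>C T x)"
proof safe
  assume T: "bounded_linear T" and i: "\<forall>x. T (\<i> *\<^sub>C x) = \<i> *\<^sub>C T x"
  have dec: "c *\<^sub>C x = Re c *\<^sub>R x + Im c *\<^sub>R (\<i> *\<^sub>C x)" for c and x :: 'a
  proof -
    have "c = of_real (Re c) + of_real (Im c) * \<i>" by (simp add: complex_eq_iff)
    then show ?thesis by (metis scaleC_add_left scaleC_of_real scaleC_scaleC)
  qed
  have "T (c *\<^sub>C x) = c *\<^sub>C T x" for c x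
    unfolding dec[of c x] dec[of c "T x"]
    using T i by (simp add: linear_simps)
  then show "bounded_clinear T" using T by (simp add: bounded_clinear_def)
qed (simp_all add: bounded_clinear_def)

lemma bounded_linear_scaleC_ii: "bounded_linear (\<lambda>x::'a::complex_inner. \<i> *\<^sub>C x)"
proof (rule bounded_linear_intro[where K = 1])
  fix x y :: 'a and r :: real
  show "\<i> *\<^sub>C (x + y) = \<i> *\<^sub>C x + \<i> *\<^sub>C y" by (rule scaleC_add_right)
  show "\<i> *\<^sub>C (r *\<^sub>R x) = r *\<^sub>R (\<i> *\<^sub>C x)"
    by (simp add: scaleC_scaleC mult.commute flip: scaleC_of_real)
  have "inner (\<i> *\<^sub>C x) (\<i> *\<^sub>C x) = inner x x"
    using inner_scaleC_ii[of x "\<i> *\<^sub>C x"] scaleC_of_real[of "-1" x] by (simp add: scaleC_scaleC)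
  then show "norm (\<i> *\<^sub>C x) \<le> norm x * 1" by (simp add: norm_eq_sqrt_inner)
qed

lemma adj_pair_bounded_clinear:
  fixes T :: "'a::complex_inner \<Rightarrow> 'a"
  assumes "bounded_clinear T" and "adj_pair T S"
  shows "bounded_clinear S"
proof -
  have "S (\<i> *\<^sub>C y) = \<i> *\<^sub>C S y" for y
  proof (subst vector_eq_ldot[symmetric], rule allI)
    fix x
    have "inner x (S (\<i> *\<^sub>C y)) = inner (T x) (\<i> *\<^sub>C y)"
      by (rule adj_pairD[OF assms(2), symmetric])
    also have "\<dots> = - inner (T (\<i> *\<^sub>C x)) y"
      using assms(1) inner_scaleC_ii[of "T x" y] by (simp add: bounded_clinear_iff)
    also have "\<dots> = inner x (\<i> *\<^sub>C S y)"
      using inner_scaleC_ii[of x "S y"] by (simp add: adj_pairD[OF assms(2)])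
    finally show "inner x (S (\<i> *\<^sub>C y)) = inner x (\<i> *\<^sub>C S y)" .
  qed
  then show ?thesis
    using assms adj_pair_bounded_linear by (auto simp: bounded_clinear_iff)
qed

text \<open>
  The imaginary part of \<open>cinner x y\<close> is a real inner product with \<open>-\<i> x\<close>, so for complex linear
  operators the real adjoint relation is the complex one.
\<close>

lemma cinner_adj_iff:
  fixes T :: "'a::complex_inner \<Rightarrow> 'a"
  assumes "bounded_clinear T"
  shows "(\<forall>x y. cinner (T x) y = cinner x (S y)) \<longleftrightarrow> adj_pair T S"
proof
  assume "\<forall>x y. cinner (T x) y = cinner x (S y)"
  then show "adj_pair T S" unfolding adj_pair_def by (metis Re_cinner)
next
  assume S: "adj_pair T S"
  have "- \<i> *\<^sub>C T x = T (- \<i> *\<^sub>C x)" for x using assms by (simp add: bounded_clinear_def)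
  then show "\<forall>x y. cinner (T x) y = cinner x (S y)"
    by (simp add: cinner_eq_inner adj_pairD[OF S])
qed

lemma op_adj_eqI:
  fixes T :: "'a::complex_hilbert_space \<Rightarrow> 'a"
  assumes "bounded_clinear T" and "adj_pair T S"
  shows "op_adj T = S"
  unfolding op_adj_def cinner_adj_iff[OF assms(1)]
  using assms adj_pair_bounded_clinear adj_pair_unique by blast

lemma adj_pair_op_adj:
  fixes T :: "'a::complex_hilbert_space \<Rightarrow> 'a"
  assumes "bounded_clinear T"
  shows "adj_pair T (op_adj T)"
proof -
  have "bounded_linear T" using assms by (simp add: bounded_clinear_def)
  then obtain S where "adj_pair T S" by (rule adj_pair_exists)
  then show ?thesis using op_adj_eqI[OF assms] by simp
qed

section \<open>The binomial series of the square root\<close>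

text \<open>
  The Taylor coefficients of \<open>sqrt (1 - x)\<close> at 0.
\<close>

definition sqrt_coeff :: "nat \<Rightarrow> real" where
  "sqrt_coeff k = ((1/2) gchoose k) * (-1) ^ k"

lemma sqrt_coeff_0 [simp]: "sqrt_coeff 0 = 1"
  by (simp add: sqrt_coeff_def)

lemma gbinomial_Suc_ratio:
  "(a gchoose Suc k) = (a gchoose k) * ((a - real k) / real (Suc k))" for a :: real
  by (metis add_diff_cancel_left' gbinomial_absorb_comp gbinomial_absorption mult.commute
      nonzero_mult_div_cancel_left of_nat_eq_0_iff nat.distinct(1) times_divide_eq_right)

lemma sqrt_coeff_nonpos: "sqrt_coeff (Suc k) \<le> 0"
proof (induction k)
  case 0
  show ?case by (simp add: sqrt_coeff_def)
next
  case (Suc k)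
  have "sqrt_coeff (Suc (Suc k)) = sqrt_coeff (Suc k) * ((real (Suc k) - 1/2) / real (Suc (Suc k)))"
    unfolding sqrt_coeff_def gbinomial_Suc_ratio[of "1/2" "Suc k"] by (simp add: field_simps)
  then show ?case using Suc by (simp add: mult_nonpos_nonneg divide_nonpos_pos)
qed

text \<open>
  The partial sums at \<open>x = 1\<close> are, up to sign, binomial coefficients of \<open>-1/2\<close>.  Since only the
  leading coefficient is positive, this one inequality gives both absolute summability
  and, later, positivity of the operator series.
\<close>

lemma sum_sqrt_coeff_nonneg: "0 \<le> (\<Sum>k\<le>n. sqrt_coeff k)"
proof -
  have "0 \<le> (- 1) ^ n * ((-1/2::real) gchoose n)"
  proof (induction n)
    case (Suc n)
    have "(- 1) ^ Suc n * ((-1/2::real) gchoose Suc n) =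
        ((- 1) ^ n * ((-1/2) gchoose n)) * ((1/2 + real n) / real (Suc n))"
      unfolding gbinomial_Suc_ratio[of "-1/2" n] by (simp add: field_simps)
    then show ?case using Suc by simp
  qed simp
  then show ?thesis
    using gbinomial_sum_lower_neg[of "1/2::real" n] by (simp add: sqrt_coeff_def)
qed

lemma sqrt_coeff_abs_summable: "(\<lambda>k. \<bar>sqrt_coeff k\<bar>) summable_on UNIV"
proof -
  have "(\<Sum>k\<le>n. \<bar>sqrt_coeff k\<bar>) = 2 - (\<Sum>k\<le>n. sqrt_coeff k)" for n
    using sqrt_coeff_nonpos by (induction n) (auto simp: abs_if less_le)
  then have "(\<Sum>k\<le>n. \<bar>sqrt_coeff k\<bar>) \<le> 2" for n using sum_sqrt_coeff_nonneg[of n] by simp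
  then have "(\<Sum>k<n. \<bar>sqrt_coeff k\<bar>) \<le> 2" for n
    by (cases n) (auto simp: lessThan_Suc_atMost simp del: sum.lessThan_Suc)
  then have "summable (\<lambda>k. \<bar>sqrt_coeff k\<bar>)"
    by (intro summableI_nonneg_bounded[where x = 2]) auto
  then show ?thesis by (subst summable_on_UNIV_nonneg_real_iff) auto
qed

lemma infsum_sqrt_coeff_nonneg: "0 \<le> infsum sqrt_coeff UNIV"
proof -
  have "sqrt_coeff summable_on UNIV"
    using sqrt_coeff_abs_summable abs_summable_summable[of sqrt_coeff UNIV] by simp
  then have "sqrt_coeff sums infsum sqrt_coeff UNIV" by (intro has_sum_imp_sums has_sum_infsum)
  then have "(\<lambda>n. \<Sum>k\<le>n. sqrt_coeff k) \<longlonglongrightarrow> infsum sqrt_coeff UNIV"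
    by (simp add: sums_def_le)
  then show ?thesis by (rule LIMSEQ_le_const) (auto intro: sum_sqrt_coeff_nonneg)
qed

text \<open>
  Vandermonde's identity for \<open>1/2 + 1/2 = 1\<close>: the square of the series is \<open>1 - x\<close>.
\<close>

lemma sqrt_coeff_convolution:
  "(\<Sum>j\<le>n. sqrt_coeff j * sqrt_coeff (n - j)) = (if n = 0 then 1 else if n = 1 then -1 else 0)"
proof -
  have "(\<Sum>j\<le>n. sqrt_coeff j * sqrt_coeff (n - j)) =
      (\<Sum>j\<le>n. ((1/2) gchoose j) * ((1/2) gchoose (n - j))) * (-1) ^ n"
    unfolding sum_distrib_right
  proof (rule sum.cong[OF refl])
    fix j assume "j \<in> {..n}"
    then have "(-1::real) ^ n = (-1) ^ j * (-1) ^ (n - j)" by (simp flip: power_add)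
    then show "sqrt_coeff j * sqrt_coeff (n - j) =
        ((1/2) gchoose j) * ((1/2) gchoose (n - j)) * (-1) ^ n"
      by (simp add: sqrt_coeff_def)
  qed
  also have "\<dots> = ((1::real) gchoose n) * (-1) ^ n"
    using gbinomial_Vandermonde[of "1/2::real" "1/2" n] by (simp add: atLeast0AtMost)
  also have "(1::real) gchoose n = real (1 choose n)"
    by (simp add: binomial_gbinomial)
  finally show ?thesis by (cases n rule: nat.exhaust; cases "n - 1") auto
qed

text \<open>
  The square root of \<open>1 - X\<close>.  The series is summed pointwise, which converges already for
  \<open>norm X \<le> 1\<close>.
\<close>

definition sqrt_one_minus :: "('a::{real_inner,banach} \<Rightarrow> 'a) \<Rightarrow> 'a \<Rightarrow> 'a" where
  "sqrt_one_minus X x = (\<Sum>\<^sub>\<infinity>k. sqrt_coeff k *\<^sub>R (X ^^ k) x)"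

lemma funpow_commute:
  assumes "\<And>x. L (X x) = X (L x)"
  shows "L ((X ^^ k) x) = (X ^^ k) (L x)"
  using assms by (induction k) auto

lemma norm_funpow_le:
  fixes X :: "'a::real_normed_vector \<Rightarrow> 'a"
  assumes "\<And>x. norm (X x) \<le> norm x"
  shows "norm ((X ^^ k) x) \<le> norm x"
  using assms by (induction k) (auto intro: order_trans)

lemma bounded_linear_funpow:
  fixes X :: "'a::real_normed_vector \<Rightarrow> 'a"
  assumes "bounded_linear X"
  shows "bounded_linear (X ^^ k)"
proof (induction k)
  case (Suc k)
  then show ?case using bounded_linear_compose[OF assms Suc.IH] by (simp add: comp_def)
qed (simp add: id_def bounded_linear_ident)

lemma adj_pair_funpow: "adj_pair X X \<Longrightarrow> adj_pair (X ^^ k) (X ^^ k)"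
proof (induction k)
  case (Suc k)
  have "adj_pair (X \<circ> X ^^ k) (X ^^ k \<circ> X)" by (intro adj_pair_comp Suc)
  then show ?case by (simp only: funpow.simps(2) funpow_Suc_right[symmetric])
qed (simp add: adj_pair_def)

context
  fixes X :: "'a::{real_inner,banach} \<Rightarrow> 'a"
  assumes bl: "bounded_linear X" and contr: "\<And>x. norm (X x) \<le> norm x"
begin

lemma sqrt_series_norm_summable:
  "(\<lambda>k. norm (sqrt_coeff k *\<^sub>R (X ^^ k) x)) summable_on UNIV"
proof (rule Infinite_Sum.abs_summable_on_comparison_test')
  show "(\<lambda>k. \<bar>sqrt_coeff k\<bar> * norm x) summable_on UNIV"
    by (intro summable_on_cmult_left sqrt_coeff_abs_summable)
qed (simp add: mult_left_mono norm_funpow_le contr)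

lemma sqrt_series_summable: "(\<lambda>k. sqrt_coeff k *\<^sub>R (X ^^ k) x) summable_on UNIV"
  by (rule abs_summable_summable[OF sqrt_series_norm_summable])

lemma bounded_linear_sqrt_one_minus: "bounded_linear (sqrt_one_minus X)"
proof (rule bounded_linear_intro[where K = "\<Sum>\<^sub>\<infinity>k. \<bar>sqrt_coeff k\<bar>"])
  fix x y :: 'a and r :: real
  note lin = bounded_linear.linear[OF bounded_linear_funpow[OF bl]]
  show "sqrt_one_minus X (x + y) = sqrt_one_minus X x + sqrt_one_minus X y"
    unfolding sqrt_one_minus_def linear_add[OF lin] scaleR_add_right
    by (intro infsum_add sqrt_series_summable)
  have "sqrt_one_minus X (r *\<^sub>R x) = (\<Sum>\<^sub>\<infinity>k. r *\<^sub>R sqrt_coeff k *\<^sub>R (X ^^ k) x)"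
    unfolding sqrt_one_minus_def linear_scale[OF lin] by (simp add: mult.commute)
  then show "sqrt_one_minus X (r *\<^sub>R x) = r *\<^sub>R sqrt_one_minus X x"
    unfolding sqrt_one_minus_def by (simp only: infsum_scaleR_right)
  have "norm (sqrt_one_minus X x) \<le> (\<Sum>\<^sub>\<infinity>k. norm (sqrt_coeff k *\<^sub>R (X ^^ k) x))"
    unfolding sqrt_one_minus_def by (rule norm_infsum_bound[OF sqrt_series_norm_summable])
  also have "\<dots> \<le> (\<Sum>\<^sub>\<infinity>k. \<bar>sqrt_coeff k\<bar> * norm x)"
    by (intro infsum_mono sqrt_series_norm_summable summable_on_cmult_left sqrt_coeff_abs_summable)
      (simp add: mult_left_mono norm_funpow_le contr)
  also have "\<dots> = norm x * (\<Sum>\<^sub>\<infinity>k. \<bar>sqrt_coeff k\<bar>)"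
    by (subst infsum_cmult_left) (auto intro: sqrt_coeff_abs_summable)
  finally show "norm (sqrt_one_minus X x) \<le> norm x * (\<Sum>\<^sub>\<infinity>k. \<bar>sqrt_coeff k\<bar>)" .
qed

lemma bounded_linear_apply_sqrt_one_minus:
  assumes "bounded_linear L"
  shows "L (sqrt_one_minus X x) = (\<Sum>\<^sub>\<infinity>k. sqrt_coeff k *\<^sub>R L ((X ^^ k) x))"
proof -
  have "((\<lambda>k. L (sqrt_coeff k *\<^sub>R (X ^^ k) x)) has_sum L (sqrt_one_minus X x)) UNIV"
    unfolding sqrt_one_minus_def
    by (intro has_sum_bounded_linear[OF assms] has_sum_infsum sqrt_series_summable)
  then show ?thesis
    by (simp add: infsumI linear_scale[OF bounded_linear.linear[OF assms]])
qed

lemma sqrt_one_minus_commute: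
  assumes "bounded_linear L" and "\<And>x. L (X x) = X (L x)"
  shows "L (sqrt_one_minus X x) = sqrt_one_minus X (L x)"
  unfolding bounded_linear_apply_sqrt_one_minus[OF assms(1)]
  by (simp add: sqrt_one_minus_def funpow_commute[where L = L and X = X] assms(2))

text \<open>
  Cauchy product: the absolutely summable double family over \<open>(j, k)\<close> is regrouped along the
  diagonals \<open>j + k = n\<close>, where the convolution identity leaves only \<open>n = 0\<close> and \<open>n = 1\<close>.
\<close>

lemma sqrt_one_minus_square: "sqrt_one_minus X (sqrt_one_minus X x) = x - X x"
proof -
  define f where "f = (\<lambda>(j, k). (sqrt_coeff j * sqrt_coeff k) *\<^sub>R (X ^^ (j + k)) x)"
  have "(\<lambda>(j, k). \<bar>sqrt_coeff j\<bar> * \<bar>sqrt_coeff k\<bar>) summable_on UNIV \<times> UNIV"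
  proof (rule summable_on_SigmaI)
    show "((\<lambda>k. case (j, k) of (j, k) \<Rightarrow> \<bar>sqrt_coeff j\<bar> * \<bar>sqrt_coeff k\<bar>) has_sum
        \<bar>sqrt_coeff j\<bar> * (\<Sum>\<^sub>\<infinity>k. \<bar>sqrt_coeff k\<bar>)) UNIV" for j
      by (auto intro!: has_sum_cmult_right has_sum_infsum sqrt_coeff_abs_summable)
    show "(\<lambda>j. \<bar>sqrt_coeff j\<bar> * (\<Sum>\<^sub>\<infinity>k. \<bar>sqrt_coeff k\<bar>)) summable_on UNIV"
      by (intro summable_on_cmult_left sqrt_coeff_abs_summable)
  qed auto
  then have "(\<lambda>p. (case p of (j, k) \<Rightarrow> \<bar>sqrt_coeff j\<bar> * \<bar>sqrt_coeff k\<bar>) * norm x)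
      summable_on UNIV \<times> UNIV"
    by (rule summable_on_cmult_left)
  then have "(\<lambda>p. norm (f p)) summable_on UNIV \<times> UNIV"
    by (rule Infinite_Sum.abs_summable_on_comparison_test')
      (auto simp: f_def abs_mult intro!: mult_left_mono norm_funpow_le contr)
  then have fs: "f summable_on UNIV \<times> UNIV" by (rule abs_summable_summable)
  let ?g = "\<lambda>(n::nat, j). f (j, n - j)" and ?D = "SIGMA n:UNIV. {..n::nat}"
  have bij: "infsum ?g ?D = infsum f (UNIV \<times> UNIV)"
    by (rule infsum_reindex_bij_witness[where i = "\<lambda>(j, k). (j + k, j)" and j = "\<lambda>(n, j). (j, n - j)"])
      auto
  have gs: "?g summable_on ?D"
    using fs by (subst summable_on_reindex_bij_witness[where i = "\<lambda>(j, k). (j + k, j)"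
        and j = "\<lambda>(n, j). (j, n - j)" and T = "UNIV \<times> UNIV" and h = f]) auto
  have "sqrt_one_minus X (sqrt_one_minus X x) = (\<Sum>\<^sub>\<infinity>j. \<Sum>\<^sub>\<infinity>k. f (j, k))"
  proof -
    have "sqrt_coeff j *\<^sub>R (X ^^ j) (sqrt_one_minus X x) = (\<Sum>\<^sub>\<infinity>k. f (j, k))" for j
      unfolding bounded_linear_apply_sqrt_one_minus[OF bounded_linear_funpow[OF bl]] f_def
      by (simp add: funpow_add flip: infsum_scaleR_right)
    then show ?thesis by (simp add: sqrt_one_minus_def[of X "sqrt_one_minus X x"])
  qed
  also have "\<dots> = (\<Sum>\<^sub>\<infinity>n. \<Sum>\<^sub>\<infinity>j\<in>{..n}. ?g (n, j))"
    unfolding infsum_Sigma_banach[OF gs] infsum_Sigma_banach[OF fs] bij ..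
  also have "\<dots> = (\<Sum>\<^sub>\<infinity>n::nat. if n = 0 then x else if n = 1 then - X x else 0)"
  proof (rule Infinite_Sum.infsum_cong)
    fix n :: nat
    have "(\<Sum>\<^sub>\<infinity>j\<in>{..n}. ?g (n, j)) = (\<Sum>j\<le>n. (sqrt_coeff j * sqrt_coeff (n - j)) *\<^sub>R (X ^^ n) x)"
      by (simp add: f_def)
    also have "\<dots> = (\<Sum>j\<le>n. sqrt_coeff j * sqrt_coeff (n - j)) *\<^sub>R (X ^^ n) x"
      by (simp add: scaleR_sum_left)
    finally show "(\<Sum>\<^sub>\<infinity>j\<in>{..n}. ?g (n, j)) = (if n = 0 then x else if n = 1 then - X x else 0)"
      by (simp add: sqrt_coeff_convolution)
  qed
  also have "\<dots> = (\<Sum>\<^sub>\<infinity>n\<in>{0, 1::nat}. if n = 0 then x else if n = 1 then - X x else 0)"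
    by (rule infsum_cong_neutral) auto
  finally show ?thesis by simp
qed

lemma sqrt_one_minus_selfadjoint:
  assumes "adj_pair X X"
  shows "adj_pair (sqrt_one_minus X) (sqrt_one_minus X)"
  unfolding adj_pair_def
proof safe
  fix x y
  have "inner (sqrt_one_minus X x) y = (\<Sum>\<^sub>\<infinity>k. sqrt_coeff k *\<^sub>R inner ((X ^^ k) x) y)"
    by (rule bounded_linear_apply_sqrt_one_minus[OF bounded_linear_inner_left])
  also have "\<dots> = (\<Sum>\<^sub>\<infinity>k. sqrt_coeff k *\<^sub>R inner x ((X ^^ k) y))"
    by (simp add: adj_pairD[OF adj_pair_funpow[OF assms]])
  also have "\<dots> = inner x (sqrt_one_minus X y)"
    by (rule bounded_linear_apply_sqrt_one_minus[OF bounded_linear_inner_right, symmetric])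
  finally show "inner (sqrt_one_minus X x) y = inner x (sqrt_one_minus X y)" .
qed

text \<open>
  All coefficients but the leading one are nonpositive and \<open><X^k x, x> \<le> norm x^2\<close>, so the form is
  at least \<open>norm x^2\<close> times the sum of the coefficients.
\<close>

lemma sqrt_one_minus_nonneg: "0 \<le> inner (sqrt_one_minus X x) x"
proof -
  have s: "sqrt_coeff summable_on UNIV"
    using sqrt_coeff_abs_summable abs_summable_summable[of sqrt_coeff UNIV] by simp
  have "0 \<le> infsum sqrt_coeff UNIV * inner x x"
    by (simp add: infsum_sqrt_coeff_nonneg)
  also have "\<dots> = (\<Sum>\<^sub>\<infinity>k. sqrt_coeff k * inner x x)"
    using s by (simp add: infsum_cmult_left)
  also have "\<dots> \<le> (\<Sum>\<^sub>\<infinity>k. inner (sqrt_coeff k *\<^sub>R (X ^^ k) x) x)"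
  proof (rule infsum_mono)
    show "(\<lambda>k. sqrt_coeff k * inner x x) summable_on UNIV" by (intro summable_on_cmult_left s)
    show "(\<lambda>k. inner (sqrt_coeff k *\<^sub>R (X ^^ k) x) x) summable_on UNIV"
      by (intro summable_on_bounded_linear[OF bounded_linear_inner_left] sqrt_series_summable)
    fix k
    have "inner ((X ^^ k) x) x \<le> norm ((X ^^ k) x) * norm x" by (rule norm_cauchy_schwarz)
    also have "\<dots> \<le> norm x * norm x" by (intro mult_right_mono norm_funpow_le contr) simp
    also have "\<dots> = inner x x" by (simp add: dot_square_norm power2_eq_square)
    finally have le: "inner ((X ^^ k) x) x \<le> inner x x" .
    show "sqrt_coeff k * inner x x \<le> inner (sqrt_coeff k *\<^sub>R (X ^^ k) x) x"
      using mult_left_mono_neg[OF le] sqrt_coeff_nonpos by (cases k) auto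
  qed
  also have "\<dots> = inner (sqrt_one_minus X x) x"
    using bounded_linear_apply_sqrt_one_minus[OF bounded_linear_inner_left, of x x] by simp
  finally show ?thesis .
qed

end

section \<open>Positive operators\<close>

definition pos_op :: "('a::real_inner \<Rightarrow> 'a) \<Rightarrow> bool" where
  "pos_op A \<longleftrightarrow> bounded_linear A \<and> adj_pair A A \<and> (\<forall>x. 0 \<le> inner (A x) x)"

text \<open>
  A substitute for the Cauchy-Schwarz inequality of the form \<open><A x, y>\<close>: evaluate the form at
  \<open>K x - A x\<close>.
\<close>

lemma pos_op_norm_le:
  assumes "pos_op A"
  obtains K where "K > 0" and "\<And>x. norm (A x) \<le> norm x * K"
    and "\<And>x. (norm (A x))\<^sup>2 \<le> K * inner (A x) x"
proof -
  from assms have bl: "bounded_linear A" and adj: "adj_pair A A"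
    and pos: "\<And>x. 0 \<le> inner (A x) x" by (auto simp: pos_op_def)
  obtain K where K: "K > 0" and le: "\<And>x. norm (A x) \<le> norm x * K"
    using bounded_linear.pos_bounded[OF bl] by blast
  have "(norm (A x))\<^sup>2 \<le> K * inner (A x) x" for x
  proof -
    have "inner (A (A x)) (A x) \<le> norm (A (A x)) * norm (A x)" by (rule norm_cauchy_schwarz)
    also have "\<dots> \<le> norm (A x) * K * norm (A x)" by (intro mult_right_mono le) simp
    finally have 1: "inner (A (A x)) (A x) \<le> K * (norm (A x))\<^sup>2"
      by (simp add: power2_eq_square ac_simps)
    have "0 \<le> inner (A (K *\<^sub>R x - A x)) (K *\<^sub>R x - A x)" by (rule pos)
    also have "\<dots> = K\<^sup>2 * inner (A x) x - 2 * K * (norm (A x))\<^sup>2 + inner (A (A x)) (A x)"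
      using adj_pairD[OF adj, of "A x" x]
      by (simp add: linear_simps[OF bl] inner_diff inner_commute dot_square_norm power2_eq_square
          algebra_simps)
    finally have "K * (norm (A x))\<^sup>2 \<le> K * (K * inner (A x) x)"
      using 1 by (simp add: power2_eq_square algebra_simps)
    then show ?thesis using K by simp
  qed
  then show thesis using that K le by blast
qed

lemma pos_op_kernel:
  assumes "pos_op A" and "inner (A x) x = 0"
  shows "A x = 0"
proof -
  obtain K where "(norm (A x))\<^sup>2 \<le> K * inner (A x) x"
    using pos_op_norm_le[OF assms(1)] by metis
  then show ?thesis by (simp add: assms(2))
qed

text \<open>
  After scaling, \<open>X = 1 - A / K\<close> is a contraction, so the binomial series applies to it.
\<close>

lemma pos_op_sqrt_exists:
  fixes A :: "'a::{real_inner,banach} \<Rightarrow> 'a"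
  assumes "pos_op A"
  obtains S where "pos_op S" and "S \<circ> S = A"
    and "\<And>L. bounded_linear L \<Longrightarrow> L \<circ> A = A \<circ> L \<Longrightarrow> L \<circ> S = S \<circ> L"
proof -
  from assms have bl: "bounded_linear A" and adj: "adj_pair A A" by (auto simp: pos_op_def)
  obtain K where K: "K > 0" and le: "\<And>x. (norm (A x))\<^sup>2 \<le> K * inner (A x) x"
    using pos_op_norm_le[OF assms] by metis
  define X where "X x = x - (1 / K) *\<^sub>R A x" for x
  have blX: "bounded_linear X"
    unfolding X_def by (intro bounded_linear_sub bounded_linear_ident
        bounded_linear_compose[OF bounded_linear_scaleR_right bl])
  have adjX: "adj_pair X X"
    by (simp add: adj_pair_def X_def inner_diff adj_pairD[OF adj])
  have "(norm (X x))\<^sup>2 \<le> (norm x)\<^sup>2" for x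
  proof -
    have "(norm (X x))\<^sup>2 = (norm x)\<^sup>2 - 2 / K * inner (A x) x + (norm (A x))\<^sup>2 / K\<^sup>2"
      unfolding X_def power2_norm_eq_inner
      by (simp add: inner_diff inner_commute power2_eq_square algebra_simps)
    also have "(norm (A x))\<^sup>2 / K\<^sup>2 \<le> (K * inner (A x) x) / K\<^sup>2"
      by (intro divide_right_mono le) simp
    also have "(K * inner (A x) x) / K\<^sup>2 = 1 / K * inner (A x) x"
      using K by (simp add: power2_eq_square)
    finally have "(norm (X x))\<^sup>2 \<le> (norm x)\<^sup>2 - 1 / K * inner (A x) x" by linarith
    moreover have "0 \<le> 1 / K * inner (A x) x" using K assms by (simp add: pos_op_def)
    ultimately show ?thesis by linarith
  qed
  then have contr: "norm (X x) \<le> norm x" for x by (rule power2_le_imp_le) simp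
  define S where "S x = sqrt K *\<^sub>R sqrt_one_minus X x" for x
  note blR = bounded_linear_sqrt_one_minus[OF blX contr]
  have "bounded_linear S"
    unfolding S_def by (rule bounded_linear_compose[OF bounded_linear_scaleR_right blR])
  moreover have "adj_pair S S"
    by (simp add: adj_pair_def S_def adj_pairD[OF sqrt_one_minus_selfadjoint[OF blX contr adjX]])
  moreover have "0 \<le> inner (S x) x" for x
    using K sqrt_one_minus_nonneg[OF blX contr, of x] by (simp add: S_def)
  ultimately have "pos_op S" by (simp add: pos_op_def)
  moreover have "S (S x) = A x" for x
  proof -
    have "S (S x) = K *\<^sub>R sqrt_one_minus X (sqrt_one_minus X x)"
      using K by (simp add: S_def linear_simps[OF blR])
    also have "\<dots> = K *\<^sub>R (x - X x)" by (simp only: sqrt_one_minus_square[OF blX contr])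
    also have "\<dots> = A x" using K by (simp add: X_def)
    finally show ?thesis .
  qed
  then have "S \<circ> S = A" by auto
  moreover have "L \<circ> S = S \<circ> L" if L: "bounded_linear L" "L \<circ> A = A \<circ> L" for L
  proof -
    have LA: "L (A x) = A (L x)" for x using L(2) by (metis comp_apply)
    have "L (X x) = X (L x)" for x by (simp add: X_def linear_simps[OF L(1)] LA)
    then have "L (sqrt_one_minus X x) = sqrt_one_minus X (L x)" for x
      by (rule sqrt_one_minus_commute[OF blX contr L(1)])
    then show ?thesis by (auto simp: S_def linear_simps[OF L(1)])
  qed
  ultimately show thesis by (rule that)
qed

text \<open>
  Both roots are compared with the root \<open>Q\<close> that commutes with everything commuting with the
  square.  A root \<open>P\<close> commutes with its square, hence with \<open>Q\<close>, and then
  \<open>(Q + P) (Q - P) = 0\<close>; positivity of \<open>Q\<close> and \<open>P\<close> makes both vanish on the range of \<open>Q - P\<close>.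
\<close>

lemma pos_op_sqrt_unique:
  fixes R S :: "'a::{real_inner,banach} \<Rightarrow> 'a"
  assumes "pos_op R" and "pos_op S" and "R \<circ> R = S \<circ> S"
  shows "R = S"
proof -
  have RR: "pos_op (R \<circ> R)"
  proof -
    have "bounded_linear (R \<circ> R)" 
      using assms(1) bounded_linear_compose[of R R] by (simp add: pos_op_def comp_def)
    moreover have "adj_pair (R \<circ> R) (R \<circ> R)" using assms(1) by (simp add: pos_op_def adj_pair_comp)
    moreover have "0 \<le> inner ((R \<circ> R) x) x" for x
      using assms(1) adj_pairD[of R R "R x" x] by (simp add: pos_op_def)
    ultimately show ?thesis by (simp add: pos_op_def)
  qed
  obtain Q where Q: "pos_op Q" "Q \<circ> Q = R \<circ> R"
    and comm: "\<And>L. bounded_linear L \<Longrightarrow> L \<circ> (R \<circ> R) = (R \<circ> R) \<circ> L \<Longrightarrow> L \<circ> Q = Q \<circ> L"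
    using pos_op_sqrt_exists[OF RR] by blast
  have eq_Q: "P = Q" if P: "pos_op P" "P \<circ> P = R \<circ> R" for P
  proof
    fix x
    have blP: "bounded_linear P" and blQ: "bounded_linear Q"
      and adj: "adj_pair P P" "adj_pair Q Q"
      using P Q by (auto simp: pos_op_def)
    have "P \<circ> Q = Q \<circ> P" by (rule comm[OF blP]) (simp only: P(2)[symmetric] comp_assoc)
    then have PQ: "P (Q z) = Q (P z)" for z by (metis comp_apply)
    have sq: "Q (Q z) = P (P z)" for z using P(2) Q(2) by (metis comp_apply)
    define y where "y = Q x - P x"
    have "Q y + P y = 0" by (simp add: y_def linear_simps[OF blP] linear_simps[OF blQ] PQ sq)
    then have "inner (Q y) y + inner (P y) y = 0" by (metis inner_add_left inner_zero_left)
    moreover have "0 \<le> inner (Q y) y" "0 \<le> inner (P y) y" using P Q by (auto simp: pos_op_def)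
    ultimately have "inner (Q y) y = 0" "inner (P y) y = 0" by linarith+
    then have "Q y = 0" "P y = 0" using pos_op_kernel P(1) Q(1) by blast+
    moreover have "inner y y = inner x (Q y - P y)"
      by (subst (1) y_def) (simp add: inner_diff adj_pairD[OF adj(1)] adj_pairD[OF adj(2)])
    ultimately have "y = 0" by simp
    then show "P x = Q x" by (simp add: y_def)
  qed
  show ?thesis using eq_Q[of R] eq_Q[of S] assms by simp
qed

text \<open>
  With \<open>S\<close> the root of \<open>P\<close>, which commutes with \<open>Q\<close>: \<open><P Q x, x> = <Q S x, S x>\<close>.
\<close>

lemma pos_op_comp_commute:
  fixes P Q :: "'a::{real_inner,banach} \<Rightarrow> 'a"
  assumes P: "pos_op P" and Q: "pos_op Q" and PQ: "P \<circ> Q = Q \<circ> P"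
  shows "pos_op (P \<circ> Q)"
proof -
  obtain S where S: "pos_op S" "S \<circ> S = P"
    and comm: "\<And>L. bounded_linear L \<Longrightarrow> L \<circ> P = P \<circ> L \<Longrightarrow> L \<circ> S = S \<circ> L"
    using pos_op_sqrt_exists[OF P] by blast
  have "bounded_linear (P \<circ> Q)"
    using P Q bounded_linear_compose[of P Q] by (simp add: pos_op_def comp_def)
  moreover have "adj_pair (P \<circ> Q) (P \<circ> Q)"
    using P Q adj_pair_comp[of P P Q Q] by (simp add: pos_op_def PQ)
  moreover have "0 \<le> inner ((P \<circ> Q) x) x" for x
  proof -
    have "Q \<circ> S = S \<circ> Q" using comm Q PQ by (simp add: pos_op_def)
    then have QS: "Q (S z) = S (Q z)" for z by (metis comp_apply)
    have adjS: "inner (S y) z = inner y (S z)" for y z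
      using S(1) by (auto simp: pos_op_def adj_pair_def)
    have "inner ((P \<circ> Q) x) x = inner (Q (S x)) (S x)"
      by (simp add: S(2)[symmetric] adjS QS)
    then show ?thesis using Q by (simp add: pos_op_def)
  qed
  ultimately show ?thesis by (simp add: pos_op_def)
qed

lemma subspace_closure:
  fixes M :: "'a::real_normed_vector set"
  assumes "subspace M"
  shows "subspace (closure M)"
proof (rule subspaceI)
  show "0 \<in> closure M" using closure_subset subspace_0[OF assms] by blast
next
  fix x y assume "x \<in> closure M" "y \<in> closure M"
  then obtain u v where "\<And>n. u n \<in> M" "u \<longlonglongrightarrow> x" "\<And>n. v n \<in> M" "v \<longlonglongrightarrow> y"
    unfolding closure_sequential by blast
  then have "\<And>n. u n + v n \<in> M" "(\<lambda>n. u n + v n) \<longlonglongrightarrow> x + y"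
    by (auto intro: subspace_add[OF assms] tendsto_add)
  then show "x + y \<in> closure M"
    unfolding closure_sequential by (intro exI[of _ "\<lambda>n. u n + v n"]) simp
next
  fix c :: real and x assume "x \<in> closure M"
  then obtain u where "\<And>n. u n \<in> M" "u \<longlonglongrightarrow> x"
    unfolding closure_sequential by blast
  then have "\<And>n. c *\<^sub>R u n \<in> M" "(\<lambda>n. c *\<^sub>R u n) \<longlonglongrightarrow> c *\<^sub>R x"
    by (auto intro: subspace_scale[OF assms] tendsto_scaleR)
  then show "c *\<^sub>R x \<in> closure M"
    unfolding closure_sequential by (intro exI[of _ "\<lambda>n. c *\<^sub>R u n"]) simp
qed

text \<open>
  The orthogonal splitting \<open>H = closure (range E) + ker E\<close> for self-adjoint \<open>E\<close>, with the first
  component given as a limit of values of \<open>E\<close>.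
\<close>

lemma closure_range_kernel_decomposition:
  fixes E :: "'a::{real_inner,banach} \<Rightarrow> 'a"
  assumes bl: "bounded_linear E" and adj: "adj_pair E E"
  obtains z k where "(\<lambda>n. E (z n)) \<longlonglongrightarrow> x - k" and "E k = 0"
proof -
  have sub: "subspace (closure (range E))"
  proof -
    have "subspace (range E)" 
      by (rule linear_subspace_image[OF bounded_linear.linear[OF bl] subspace_UNIV])
    then show ?thesis by (rule subspace_closure)
  qed
  obtain u where u: "u \<in> closure (range E)"
    and orth: "\<And>y. y \<in> closure (range E) \<Longrightarrow> inner (x - u) y = 0"
    using orthogonal_projection_exists[OF sub closed_closure, of x] by blast
  obtain w where w: "\<forall>n. w n \<in> range E" "w \<longlonglongrightarrow> u"
    using u unfolding closure_sequential by blast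
  have "\<forall>n. \<exists>z. w n = E z" using w(1) by blast
  then have "\<exists>z. \<forall>n. w n = E (z n)" by (rule choice)
  then obtain z where z: "\<And>n. w n = E (z n)" by blast
  have "inner (E (x - u)) y = 0" for y
    using orth[of "E y"] closure_subset[of "range E"] by (auto simp: adj_pairD[OF adj])
  then have "E (x - u) = 0" by (metis inner_eq_zero_iff)
  then show thesis using that[of z "x - u"] w(2) by (simp add: z[symmetric])
qed

text \<open>
  Let \<open>E = Q + P\<close> and \<open>N = Q - P\<close>.  The hypothesis says that \<open>N E = Q^2 - P^2\<close> is positive, hence so
  is the product \<open>E (N E)\<close> of commuting positive operators, which is positivity of \<open>N\<close> on the range of \<open>E\<close> and by continuity on its closure.
  On \<open>ker E = ker P \<inter> ker Q\<close> the operator \<open>N\<close> vanishes.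
\<close>

lemma pos_op_diff_of_norm_le:
  fixes P Q :: "'a::{real_inner,banach} \<Rightarrow> 'a"
  assumes P: "pos_op P" and Q: "pos_op Q" and PQ: "P \<circ> Q = Q \<circ> P"
    and le: "\<And>x. norm (P x) \<le> norm (Q x)"
  shows "pos_op (\<lambda>x. Q x - P x)"
proof -
  define E where "E x = Q x + P x" for x
  define N where "N x = Q x - P x" for x
  have blP: "bounded_linear P" and blQ: "bounded_linear Q"
    using P Q by (simp_all add: pos_op_def)
  have symP: "inner (P x) y = inner x (P y)" and symQ: "inner (Q x) y = inner x (Q y)" for x y
    using P Q by (simp_all add: pos_op_def adj_pair_def)
  have comm: "P (Q x) = Q (P x)" for x using PQ by (metis comp_apply)
  have blE: "bounded_linear E" unfolding E_def by (intro bounded_linear_add blP blQ)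
  have blN: "bounded_linear N" unfolding N_def by (intro bounded_linear_sub blP blQ)
  have symE: "adj_pair E E" and symN: "adj_pair N N"
    by (simp_all add: adj_pair_def E_def N_def inner_add inner_diff symP symQ)
  have posE: "pos_op E"
    using P Q by (simp add: pos_op_def blE symE) (simp add: E_def inner_add)
  have NE: "N (E x) = Q (Q x) - P (P x)" for x
    by (simp add: N_def E_def linear_simps[OF blP] linear_simps[OF blQ] comm)
  have EN: "E (N x) = N (E x)" for x
    unfolding NE by (simp add: N_def E_def linear_simps[OF blP] linear_simps[OF blQ] comm)
  have "pos_op (N \<circ> E)"
  proof -
    have "bounded_linear (N \<circ> E)" unfolding comp_def by (rule bounded_linear_compose[OF blN blE])
    moreover have "adj_pair (N \<circ> E) (N \<circ> E)"
      using symN symE EN by (simp add: adj_pair_def)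
    moreover have "0 \<le> inner ((N \<circ> E) x) x" for x
    proof -
      have "(norm (P x))\<^sup>2 \<le> (norm (Q x))\<^sup>2" using le[of x] by simp
      then show ?thesis by (simp add: NE inner_diff symP symQ dot_square_norm)
    qed
    ultimately show ?thesis by (simp add: pos_op_def)
  qed
  then have posENE: "pos_op (E \<circ> (N \<circ> E))"
    by (rule pos_op_comp_commute[OF posE]) (auto simp: EN)
  have on_range: "0 \<le> inner (N (E z)) (E z)" for z
  proof -
    have "inner (N (E z)) (E z) = inner (E (N (E z))) z" by (simp add: adj_pairD[OF symE])
    then show ?thesis using posENE by (simp add: pos_op_def)
  qed
  have "0 \<le> inner (N x) x" for x
  proof -
    obtain z k where z: "(\<lambda>n. E (z n)) \<longlonglongrightarrow> x - k" and "E k = 0"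
      using closure_range_kernel_decomposition[OF blE symE] .
    have "inner (Q k) k + inner (P k) k = 0"
      using \<open>E k = 0\<close> by (simp add: E_def flip: inner_add_left)
    moreover have "0 \<le> inner (Q k) k" "0 \<le> inner (P k) k" using P Q by (auto simp: pos_op_def)
    ultimately have "inner (Q k) k = 0" "inner (P k) k = 0" by linarith+
    then have "N k = 0" using pos_op_kernel[OF P, of k] pos_op_kernel[OF Q, of k] by (simp add: N_def)
    have "(\<lambda>n. inner (N (E (z n))) (E (z n))) \<longlonglongrightarrow> inner (N (x - k)) (x - k)"
      by (intro tendsto_inner bounded_linear.tendsto[OF blN] z)
    then have "0 \<le> inner (N (x - k)) (x - k)"
      by (rule LIMSEQ_le_const) (auto intro: on_range)
    then show ?thesis
      using \<open>N k = 0\<close> adj_pairD[OF symN, of x k]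
      by (simp add: linear_simps[OF blN] inner_diff)
  qed
  then show ?thesis using blN symN by (simp add: pos_op_def N_def[abs_def])
qed


section \<open>Polar decomposition\<close>

text \<open>
  The graph of the partial isometry \<open>A z + k \<mapsto> T z\<close> (\<open>k \<in> ker A\<close>), closed up in the
  first summand.
\<close>

definition polar_rel ::
  "('a::real_inner \<Rightarrow> 'a) \<Rightarrow> ('a \<Rightarrow> 'a) \<Rightarrow> 'a \<Rightarrow> 'a \<Rightarrow> bool" where
  "polar_rel A T x v \<longleftrightarrow>
    (\<exists>z k. (\<lambda>n. A (z n)) \<longlonglongrightarrow> x - k \<and> A k = 0 \<and> (\<lambda>n. T (z n)) \<longlonglongrightarrow> v)"

context
  fixes A T :: "'a::{real_inner,banach} \<Rightarrow> 'a"
  assumes blA: "bounded_linear A" and symA: "adj_pair A A" and blT: "bounded_linear T"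
    and norm_eq: "\<And>x. norm (T x) = norm (A x)"
begin

lemma limit_of_range_orthogonal_kernel:
  assumes "(\<lambda>n. A (z n)) \<longlonglongrightarrow> u" and "A k = 0"
  shows "inner u k = 0"
proof -
  have "(\<lambda>n. inner (A (z n)) k) \<longlonglongrightarrow> inner u k" by (intro tendsto_intros assms)
  then have "(\<lambda>n. 0) \<longlonglongrightarrow> inner u k" by (simp add: adj_pairD[OF symA] assms(2))
  then show ?thesis by (metis LIMSEQ_const_iff)
qed

lemma polar_rel_total: "\<exists>v. polar_rel A T x v"
proof -
  obtain z k where z: "(\<lambda>n. A (z n)) \<longlonglongrightarrow> x - k" and k: "A k = 0"
    using closure_range_kernel_decomposition[OF blA symA] .
  have "dist (T a) (T b) = dist (A a) (A b)" for a b
    using norm_eq[of "a - b"] by (simp add: dist_norm linear_simps[OF blA] linear_simps[OF blT])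
  then have "Cauchy (\<lambda>n. T (z n))"
    using LIMSEQ_imp_Cauchy[OF z] by (simp add: Cauchy_def)
  then show ?thesis
    unfolding polar_rel_def using z k Cauchy_convergent[of "\<lambda>n. T (z n)"] convergent_def by blast
qed

lemma polar_rel_norm:
  assumes "polar_rel A T x v"
  obtains k where "A k = 0" and "norm v = norm (x - k)" and "(norm x)\<^sup>2 = (norm v)\<^sup>2 + (norm k)\<^sup>2"
    and "inner x k = inner k k"
proof -
  obtain z k where z: "(\<lambda>n. A (z n)) \<longlonglongrightarrow> x - k" and k: "A k = 0" and v: "(\<lambda>n. T (z n)) \<longlonglongrightarrow> v"
    using assms unfolding polar_rel_def by blast
  have "(\<lambda>n. norm (A (z n))) \<longlonglongrightarrow> norm v" using tendsto_norm[OF v] by (simp add: norm_eq)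
  then have n: "norm v = norm (x - k)" by (rule LIMSEQ_unique) (rule tendsto_norm[OF z])
  have o: "inner (x - k) k = 0" by (rule limit_of_range_orthogonal_kernel[OF z k])
  then have "(norm x)\<^sup>2 = (norm (x - k))\<^sup>2 + (norm k)\<^sup>2"
    unfolding power2_norm_eq_inner by (simp add: inner_diff inner_commute)
  then show thesis using that[OF k n] n o by (simp add: inner_diff)
qed

lemma polar_rel_combination:
  assumes "polar_rel A T x v" and "polar_rel A T y w"
  shows "polar_rel A T (x + c *\<^sub>R y) (v + c *\<^sub>R w)"
proof -
  obtain z k where z: "(\<lambda>n. A (z n)) \<longlonglongrightarrow> x - k" "A k = 0" "(\<lambda>n. T (z n)) \<longlonglongrightarrow> v"
    using assms(1) unfolding polar_rel_def by blast
  obtain z' k' where z': "(\<lambda>n. A (z' n)) \<longlonglongrightarrow> y - k'" "A k' = 0" "(\<lambda>n. T (z' n)) \<longlonglongrightarrow> w"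
    using assms(2) unfolding polar_rel_def by blast
  have "(\<lambda>n. A (z n) + c *\<^sub>R A (z' n)) \<longlonglongrightarrow> (x - k) + c *\<^sub>R (y - k')"
    by (intro tendsto_intros z z')
  moreover have "(\<lambda>n. T (z n) + c *\<^sub>R T (z' n)) \<longlonglongrightarrow> v + c *\<^sub>R w"
    by (intro tendsto_intros z z')
  moreover have "(x - k) + c *\<^sub>R (y - k') = (x + c *\<^sub>R y) - (k + c *\<^sub>R k')"
    by (simp add: algebra_simps)
  ultimately show ?thesis
    unfolding polar_rel_def using z(2) z'(2)
    by (intro exI[of _ "\<lambda>n. z n + c *\<^sub>R z' n"] exI[of _ "k + c *\<^sub>R k'"])
      (simp add: linear_simps[OF blA] linear_simps[OF blT])
qed

lemma polar_rel_unique: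
  assumes "polar_rel A T x v" and "polar_rel A T x w"
  shows "v = w"
proof -
  have "polar_rel A T 0 (v - w)" using polar_rel_combination[OF assms, of "-1"] by simp
  then obtain k :: 'a where "(norm (0::'a))\<^sup>2 = (norm (v - w))\<^sup>2 + (norm k)\<^sup>2"
    using polar_rel_norm by blast
  then have "(norm (v - w))\<^sup>2 = 0"
    by (metis add_nonneg_eq_0_iff norm_zero power_zero_numeral zero_le_power2)
  then show ?thesis by simp
qed

text \<open>
  The relation is total since \<open>T z\<^sub>n\<close> is Cauchy along with \<open>A z\<^sub>n\<close>, and single-valued since it
  preserves norms up to the kernel component; so it is the graph of the required operator.  The last
  clause holds because an operator commuting with \<open>A\<close> and \<open>T\<close> maps the graph into itself.
\<close>

lemma polar_isometry_exists:
  shows "\<exists>V. bounded_linear V \<and> V \<circ> A = T \<and> (\<forall>x. norm (V x) \<le> norm x) \<and>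
      (\<forall>x. V x = 0 \<longleftrightarrow> A x = 0) \<and>
      (\<forall>x. (\<forall>k. A k = 0 \<longrightarrow> inner x k = 0) \<longrightarrow> norm (V x) = norm x) \<and>
      (\<forall>L. bounded_linear L \<longrightarrow> L \<circ> A = A \<circ> L \<longrightarrow> L \<circ> T = T \<circ> L \<longrightarrow> L \<circ> V = V \<circ> L)"
proof -
  have "\<forall>x. \<exists>v. polar_rel A T x v" using polar_rel_total by blast
  then have "\<exists>V. \<forall>x. polar_rel A T x (V x)" by (rule choice)
  then obtain V where V: "\<And>x. polar_rel A T x (V x)" by blast
  have V_eqI: "V x = v" if "polar_rel A T x v" for x v
    by (rule polar_rel_unique[OF V that])
  have rel_kernel: "polar_rel A T k 0" if "A k = 0" for k
    unfolding polar_rel_def using that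
    by (intro exI[of _ "\<lambda>n. 0"] exI[of _ k]) (simp add: linear_simps[OF blA] linear_simps[OF blT])
  have comb: "V (x + c *\<^sub>R y) = V x + c *\<^sub>R V y" for x y c
    by (intro V_eqI polar_rel_combination V)
  have le: "norm (V x) \<le> norm x" for x
  proof -
    obtain k :: 'a where "(norm x)\<^sup>2 = (norm (V x))\<^sup>2 + (norm k)\<^sup>2" using polar_rel_norm[OF V[of x]] by blast
    then have "(norm (V x))\<^sup>2 \<le> (norm x)\<^sup>2" by simp
    then show ?thesis by (rule power2_le_imp_le) simp
  qed
  have "V 0 = 0" using le[of 0] by simp
  have blV: "bounded_linear V"
  proof (rule bounded_linear_intro[where K = 1])
    show "V (x + y) = V x + V y" for x y using comb[of x 1 y] by simp
    show "V (c *\<^sub>R y) = c *\<^sub>R V y" for c y using comb[of 0 c y] \<open>V 0 = 0\<close> by simp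
    show "norm (V x) \<le> norm x * 1" for x using le by simp
  qed
  have "V (A x) = T x" for x
    by (rule V_eqI) (auto simp: polar_rel_def linear_simps[OF blA]
        intro!: exI[of _ "\<lambda>n. x"] exI[of _ 0])
  then have VA: "V \<circ> A = T" by auto
  have ker: "V x = 0 \<longleftrightarrow> A x = 0" for x
  proof
    assume "V x = 0"
    obtain k where "A k = 0" "norm (V x) = norm (x - k)" using polar_rel_norm[OF V[of x]] by blast
    then show "A x = 0" using \<open>V x = 0\<close> by simp
  qed (intro V_eqI rel_kernel)
  have isom: "norm (V x) = norm x" if "\<forall>k. A k = 0 \<longrightarrow> inner x k = 0" for x
  proof -
    obtain k where "A k = 0" "norm (V x) = norm (x - k)" "inner x k = inner k k"
      using polar_rel_norm[OF V[of x]] by blast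
    then show ?thesis using that by simp
  qed
  have comm: "L \<circ> V = V \<circ> L"
    if L: "bounded_linear L" and LA: "L \<circ> A = A \<circ> L" and LT: "L \<circ> T = T \<circ> L" for L
  proof
    fix x
    have LA': "A (L a) = L (A a)" and LT': "T (L a) = L (T a)" for a
      using LA LT by (metis comp_apply)+
    obtain z k where z: "(\<lambda>n. A (z n)) \<longlonglongrightarrow> x - k" "A k = 0" "(\<lambda>n. T (z n)) \<longlonglongrightarrow> V x"
      using V unfolding polar_rel_def by blast
    have "polar_rel A T (L x) (L (V x))"
      unfolding polar_rel_def
      using bounded_linear.tendsto[OF L z(1)] bounded_linear.tendsto[OF L z(3)] z(2)
      by (intro exI[of _ "\<lambda>n. L (z n)"] exI[of _ "L k"]) (simp add: LA' LT' linear_simps[OF L])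
    then show "(L \<circ> V) x = (V \<circ> L) x" using V_eqI by simp
  qed
  show ?thesis
    by (intro exI[of _ V] conjI allI impI; (fact blV VA le ker | rule isom comm; assumption))
qed

end


section \<open>Square root, modulus and polar factor of complex operators\<close>

text \<open>
  That a real quadratic form forces self-adjointness is special to complex spaces: the real bilinear
  form \<open>inner (\<i> S x) y\<close> vanishes on the diagonal, hence is antisymmetric, and replacing \<open>x\<close>
  by \<open>-\<i> x\<close> turns this into symmetry of \<open>S\<close>.
\<close>

lemma op_positive_iff_pos_op:
  fixes S :: "'a::complex_inner \<Rightarrow> 'a"
  assumes "bounded_clinear S"
  shows "op_positive S \<longleftrightarrow> pos_op S"
proof
  assume pos: "op_positive S"
  have bl: "bounded_linear S" and S_ii: "S (\<i> *\<^sub>C x) = \<i> *\<^sub>C S x" for x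
    using assms by (auto simp: bounded_clinear_iff)
  note i = bounded_linear_scaleC_ii
  have re: "0 \<le> inner (S x) x" and im: "inner (\<i> *\<^sub>C S x) x = 0" for x
  proof -
    have c: "Re (cinner (S x) x) \<ge> 0" "Im (cinner (S x) x) = 0"
      using pos by (simp_all add: op_positive_def complex_nonneg_Reals_iff)
    have "cinner (\<i> *\<^sub>C S x) x = \<i> * cinner (S x) x" by (rule cinner_scaleC_left)
    then have "inner (\<i> *\<^sub>C S x) x = - Im (cinner (S x) x)"
      by (simp flip: Re_cinner)
    then show "inner (\<i> *\<^sub>C S x) x = 0" using c by simp
    show "0 \<le> inner (S x) x" using c by (simp add: Re_cinner)
  qed
  have anti: "inner (\<i> *\<^sub>C S x) y = - inner (\<i> *\<^sub>C S y) x" for x y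
    using im[of "x + y"] im[of x] im[of y]
    by (simp add: linear_simps[OF bl] linear_simps[OF i] inner_add)
  have "inner (S (\<i> *\<^sub>C x)) y = inner (\<i> *\<^sub>C x) (S y)" for x y
    unfolding S_ii anti[of x y] inner_scaleC_ii[of x "S y"] by (simp add: inner_commute)
  then have "inner (S (\<i> *\<^sub>C (- \<i> *\<^sub>C x))) y = inner (\<i> *\<^sub>C (- \<i> *\<^sub>C x)) (S y)" for x y .
  then have "adj_pair S S"
    using scaleC_of_real[of 1, where 'a = 'a] by (simp add: adj_pair_def scaleC_scaleC)
  then show "pos_op S" using bl re by (simp add: pos_op_def)
next
  assume S: "pos_op S"
  have "Im (cinner (S x) x) = 0" for x
  proof -
    have "cinner (S x) x = cinner x (S x)"
      using cinner_adj_iff[OF assms, of S] S by (simp add: pos_op_def)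
    then show ?thesis using cinner_commute[of "S x" x]
      by (metis cnj.sel(2) neg_equal_zero)
  qed
  then show "op_positive S"
    using S by (simp add: op_positive_def pos_op_def complex_nonneg_Reals_iff Re_cinner)
qed

text \<open>
  The root is complex linear because it commutes with every operator commuting with \<open>A\<close>,
  such as multiplication by \<open>\<i>\<close>.
\<close>

lemma op_sqrt_is_positive_root:
  fixes A :: "'a::complex_hilbert_space \<Rightarrow> 'a"
  assumes A: "bounded_clinear A" "pos_op A"
  shows "bounded_clinear (op_sqrt A)" and "pos_op (op_sqrt A)" and "op_sqrt A \<circ> op_sqrt A = A"
    and "\<And>L. bounded_linear L \<Longrightarrow> L \<circ> A = A \<circ> L \<Longrightarrow> L \<circ> op_sqrt A = op_sqrt A \<circ> L"
    and "\<And>S. pos_op S \<Longrightarrow> S \<circ> S = A \<Longrightarrow> S = op_sqrt A"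
proof -
  obtain S where S: "pos_op S" "S \<circ> S = A"
    and comm: "\<And>L. bounded_linear L \<Longrightarrow> L \<circ> A = A \<circ> L \<Longrightarrow> L \<circ> S = S \<circ> L"
    using pos_op_sqrt_exists[OF A(2)] by blast
  have "(\<lambda>x. \<i> *\<^sub>C x) \<circ> S = S \<circ> (\<lambda>x. \<i> *\<^sub>C x)"
    using A(1) by (intro comm bounded_linear_scaleC_ii) (auto simp: bounded_clinear_iff)
  then have bc: "bounded_clinear S"
    using S(1) by (auto simp: bounded_clinear_iff pos_op_def fun_eq_iff)
  have uniq: "R = S" if "pos_op R" "R \<circ> R = A" for R
    using pos_op_sqrt_unique[OF that(1) S(1)] that(2) S(2) by simp
  have eq: "op_sqrt A = S"
    unfolding op_sqrt_def
  proof (rule the_equality)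
    show "bounded_clinear S \<and> op_positive S \<and> S \<circ> S = A"
      using bc S by (simp add: op_positive_iff_pos_op)
    show "R = S" if "bounded_clinear R \<and> op_positive R \<and> R \<circ> R = A" for R
      using that uniq[of R] op_positive_iff_pos_op[of R] by blast
  qed
  show "bounded_clinear (op_sqrt A)" "pos_op (op_sqrt A)" "op_sqrt A \<circ> op_sqrt A = A"
    "\<And>L. bounded_linear L \<Longrightarrow> L \<circ> A = A \<circ> L \<Longrightarrow> L \<circ> op_sqrt A = op_sqrt A \<circ> L"
    "\<And>S. pos_op S \<Longrightarrow> S \<circ> S = A \<Longrightarrow> S = op_sqrt A"
    unfolding eq using bc S comm uniq by blast+
qed

lemma bounded_clinear_comp:
  "bounded_clinear S \<Longrightarrow> bounded_clinear T \<Longrightarrow> bounded_clinear (S \<circ> T)"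
  using bounded_linear_compose[of S T] by (simp add: bounded_clinear_def comp_def)

lemma pos_op_adj_comp:
  assumes "bounded_linear T" and "adj_pair T S"
  shows "pos_op (S \<circ> T)"
proof -
  have "bounded_linear (S \<circ> T)"
    unfolding comp_def
    by (rule bounded_linear_compose[OF adj_pair_bounded_linear[OF assms] assms(1)])
  moreover have "adj_pair (S \<circ> T) (S \<circ> T)"
    by (intro adj_pair_comp assms adj_pair_sym)
  moreover have "0 \<le> inner ((S \<circ> T) x) x" for x
    using adj_pairD[OF adj_pair_sym[OF assms(2)], of "T x" x] by simp
  ultimately show ?thesis by (simp add: pos_op_def)
qed

lemma op_abs_is_modulus:
  fixes T :: "'a::complex_hilbert_space \<Rightarrow> 'a"
  assumes T: "bounded_clinear T"
  shows "bounded_clinear (op_abs T)" and "pos_op (op_abs T)"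
    and "op_abs T \<circ> op_abs T = op_adj T \<circ> T" and "norm (op_abs T x) = norm (T x)"
proof -
  note adj = adj_pair_op_adj[OF T]
  have bl: "bounded_linear T" using T by (simp add: bounded_clinear_def)
  have pos: "pos_op (op_adj T \<circ> T)" by (rule pos_op_adj_comp[OF bl adj])
  have bc: "bounded_clinear (op_adj T \<circ> T)"
    by (intro bounded_clinear_comp T adj_pair_bounded_clinear[OF T adj])
  note props = op_sqrt_is_positive_root[OF bc pos, folded op_abs_def]
  show "bounded_clinear (op_abs T)" "pos_op (op_abs T)"
    and sq: "op_abs T \<circ> op_abs T = op_adj T \<circ> T"
    by (fact props)+
  have "inner (op_abs T x) (op_abs T x) = inner x ((op_abs T \<circ> op_abs T) x)"
    using props(2) by (simp add: pos_op_def adj_pair_def)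
  also have "\<dots> = inner (T x) (T x)" unfolding sq by (simp add: adj_pairD[OF adj])
  finally show "norm (op_abs T x) = norm (T x)" by (simp add: norm_eq_sqrt_inner)
qed

text \<open>
  The isometry built above satisfies the conditions defining the polar factor.  Any other operator that
  does agrees with it on the range of \<open>|T|\<close>, hence on its closure, and on \<open>ker |T| = ker T\<close>.
\<close>

lemma polar_factor_is_contraction:
  fixes T :: "'a::complex_hilbert_space \<Rightarrow> 'a"
  assumes T: "bounded_clinear T"
  shows "bounded_clinear (polar_factor T)" and "polar_factor T \<circ> op_abs T = T"
    and "norm (polar_factor T x) \<le> norm x"
proof -
  let ?A = "op_abs T"
  note A = op_abs_is_modulus[OF T]
  have blA: "bounded_linear ?A" and symA: "adj_pair ?A ?A" using A(2) by (auto simp: pos_op_def)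
  have blT: "bounded_linear T" using T by (simp add: bounded_clinear_def)
  have norm_eq: "\<And>x. norm (T x) = norm (?A x)" by (simp add: A(4))
  obtain V where blV: "bounded_linear V" and VA: "V \<circ> ?A = T"
    and le: "\<forall>x. norm (V x) \<le> norm x" and ker: "\<forall>x. V x = 0 \<longleftrightarrow> ?A x = 0"
    and isom: "\<forall>x. (\<forall>k. ?A k = 0 \<longrightarrow> inner x k = 0) \<longrightarrow> norm (V x) = norm x"
    and comm: "\<forall>L. bounded_linear L \<longrightarrow> L \<circ> ?A = ?A \<circ> L \<longrightarrow> L \<circ> T = T \<circ> L \<longrightarrow> L \<circ> V = V \<circ> L"
    using polar_isometry_exists[OF blA symA blT norm_eq] by (elim exE conjE)
  have "(\<lambda>x. \<i> *\<^sub>C x) \<circ> V = V \<circ> (\<lambda>x. \<i> *\<^sub>C x)"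
    using A(1) T by (intro comm[rule_format] bounded_linear_scaleC_ii) (auto simp: bounded_clinear_iff)
  then have bcV: "bounded_clinear V"
    using blV by (auto simp: bounded_clinear_iff fun_eq_iff)
  have kerA: "?A x = 0 \<longleftrightarrow> T x = 0" for x using A(4)[of x] by (metis norm_eq_zero)
  have "norm (V x) = norm x" if "\<forall>y\<in>op_ker V. cinner x y = 0" for x
  proof (rule isom[rule_format])
    fix k assume "?A k = 0"
    then have "cinner x k = 0" using that ker by (simp add: op_ker_def)
    then show "inner x k = 0" by (simp flip: Re_cinner)
  qed
  then have "partial_isometry V" by (simp add: partial_isometry_def bcV)
  moreover have "op_ker V = op_ker T" by (simp add: op_ker_def ker kerA)
  ultimately have V: "partial_isometry V \<and> T = V \<circ> ?A \<and> op_ker V = op_ker T"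
    by (intro conjI VA[symmetric])
  have "W = V" if W: "partial_isometry W" and WA: "T = W \<circ> ?A" and kerW: "op_ker W = op_ker T" for W
  proof
    fix x
    have blW: "bounded_linear W"
      using W by (simp add: partial_isometry_def bounded_clinear_def)
    obtain z k where z: "(\<lambda>n. ?A (z n)) \<longlonglongrightarrow> x - k" and k: "?A k = 0"
      using closure_range_kernel_decomposition[OF blA symA] .
    have "W (?A y) = V (?A y)" for y
      using fun_cong[OF WA[symmetric], of y] fun_cong[OF VA, of y] unfolding comp_apply
      by (rule trans[OF _ sym])
    then have "(\<lambda>n. V (?A (z n))) \<longlonglongrightarrow> W (x - k)"
      using bounded_linear.tendsto[OF blW z] by simp
    then have "W (x - k) = V (x - k)"
      by (rule LIMSEQ_unique) (rule bounded_linear.tendsto[OF blV z])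
    moreover have "k \<in> op_ker W" unfolding kerW using k by (simp add: op_ker_def kerA)
    then have "W k = 0" by (simp add: op_ker_def)
    moreover have "V k = 0" using k by (simp add: ker)
    ultimately show "W x = V x" by (simp add: linear_simps[OF blW] linear_simps[OF blV])
  qed
  then have eq: "polar_factor T = V"
    unfolding polar_factor_def using V by (intro the_equality) blast+
  show "bounded_clinear (polar_factor T)" "polar_factor T \<circ> op_abs T = T"
    "norm (polar_factor T x) \<le> norm x"
    unfolding eq by (fact bcV VA le[rule_format])+
qed

section \<open>The mean transform\<close>

lemma co_hyponormal_iff_norm_le:
  fixes A :: "'a::complex_hilbert_space \<Rightarrow> 'a"
  assumes A: "bounded_clinear A"
  shows "co_hyponormal A \<longleftrightarrow> (\<forall>x. norm (A x) \<le> norm (op_adj A x))"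
proof -
  note adj = adj_pair_op_adj[OF A]
  note bc = adj_pair_bounded_clinear[OF A adj]
  have "cinner ((A \<circ> op_adj A) x - (op_adj A \<circ> A) x) x =
      of_real ((norm (op_adj A x))\<^sup>2 - (norm (A x))\<^sup>2)" for x
  proof -
    have sub: "cinner (u - v) x = cinner u x - cinner v x" for u v :: 'a
      using cinner_add_left[of "u - v" v x] by simp
    have "cinner (A (op_adj A x)) x = of_real ((norm (op_adj A x))\<^sup>2)"
      by (simp add: cinner_adj_iff[OF A, THEN iffD2, OF adj, rule_format] cinner_self)
    moreover have "cinner (op_adj A (A x)) x = of_real ((norm (A x))\<^sup>2)"
      by (simp add: cinner_adj_iff[OF bc, THEN iffD2, OF adj_pair_sym[OF adj], rule_format]
          cinner_self)
    ultimately show ?thesis by (simp add: sub)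
  qed
  then have "op_le (op_adj A \<circ> A) (A \<circ> op_adj A) \<longleftrightarrow> (\<forall>x. (norm (A x))\<^sup>2 \<le> (norm (op_adj A x))\<^sup>2)"
    by (simp only: op_le_def op_positive_def complex_nonneg_Reals_iff Re_complex_of_real
        Im_complex_of_real) simp
  then show ?thesis by (simp add: co_hyponormal_def A)
qed

theorem theorem2p9:
  fixes T :: "'a::complex_hilbert_space \<Rightarrow> 'a"
  assumes "bounded_clinear T"
    and "co_hyponormal T"
    and "binormal T"
  shows "co_hyponormal (mean_transform T)"
proof -
  define A V where "A = op_abs T" and "V = polar_factor T"
  define T' W where "T' = op_adj T" and "W = op_adj V"
  note A = op_abs_is_modulus[OF assms(1), folded A_def]
  note V = polar_factor_is_contraction[OF assms(1), folded A_def V_def]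
  have blT: "bounded_linear T" and blA: "bounded_linear A" and blV: "bounded_linear V"
    using assms(1) A(1) V(1) by (simp_all add: bounded_clinear_def)
  have symA: "adj_pair A A" using A(2) by (simp add: pos_op_def)
  have adjT: "adj_pair T T'" and adjV: "adj_pair V W"
    unfolding T'_def W_def using assms(1) V(1) by (auto intro: adj_pair_op_adj)
  have blW: "bounded_linear W" by (rule adj_pair_bounded_linear[OF blV adjV])
  have norm_T_le: "norm (T x) \<le> norm (T' x)" for x
    using assms(1,2) co_hyponormal_iff_norm_le T'_def by blast

  have VA: "V (A x) = T x" for x using V(2) by (metis comp_apply)
  have WVA: "W (V (A x)) = A x" for x
    by (rule contraction_adjoint_inverts[OF adjV V(3)]) (simp add: VA A(4))
  have "adj_pair T (A \<circ> W)" using adj_pair_comp[OF adjV symA] V(2) by simp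
  then have "T' = A \<circ> W" by (rule adj_pair_unique[OF adjT])
  then have AW: "A (W x) = T' x" for x by simp
  \<comment> \<open>Taking adjoints in \<open>W V A = A\<close>.\<close>
  have "adj_pair (W \<circ> V \<circ> A) (A \<circ> (W \<circ> V))"
    by (intro adj_pair_comp symA adjV adj_pair_sym[OF adjV])
  moreover have "W \<circ> V \<circ> A = A" using WVA by auto
  ultimately have "A \<circ> (W \<circ> V) = A" using adj_pair_unique[OF symA] by metis
  then have AWV: "A (W (V x)) = A x" for x by (metis comp_apply)

  have kerT: "A y = 0" if "T' y = 0" for y using norm_T_le[of y] A(4)[of y] that by simp
  \<comment> \<open>\<open>T* V W = A W V W = A W = T*\<close>, so \<open>x - V W x\<close> lies in \<open>ker T*\<close>, hence in \<open>ker A\<close>.\<close>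
  have AVW: "A (V (W x)) = A x" for x
  proof -
    have "T' (x - V (W x)) = 0"
      by (simp add: AW[symmetric] linear_simps[OF blW] linear_simps[OF blA] linear_simps[OF blV] AWV)
    then have "A (x - V (W x)) = 0" by (rule kerT)
    then show ?thesis by (simp add: linear_simps[OF blA])
  qed
  have VWA: "V (W (A x)) = A x" for x
  proof -
    have "adj_pair (A \<circ> (V \<circ> W)) (V \<circ> W \<circ> A)"
      by (intro adj_pair_comp symA adjV adj_pair_sym[OF adjV])
    moreover have "A \<circ> (V \<circ> W) = A" using AVW by auto
    ultimately have "V \<circ> W \<circ> A = A" using adj_pair_unique[OF symA] by metis
    then show ?thesis by (metis comp_apply)
  qed

  define B where "B = V \<circ> A \<circ> W"
  have posB: "pos_op B"
  proof -
    have "bounded_linear B"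
      unfolding B_def comp_def by (intro bounded_linear_compose[OF blV] bounded_linear_compose[OF blA] blW)
    moreover have "adj_pair B B"
      unfolding B_def using adj_pair_comp[OF adj_pair_comp[OF adjV symA] adj_pair_sym[OF adjV]]
      by (simp add: comp_assoc)
    moreover have "0 \<le> inner (B x) x" for x
      using A(2) by (simp add: B_def pos_op_def adj_pairD[OF adjV])
    ultimately show ?thesis by (simp add: pos_op_def)
  qed
  have BB: "B \<circ> B = T \<circ> T'" by (auto simp: B_def WVA AW[symmetric] VA[symmetric])
  have norm_B: "norm (B x) = norm (T' x)" for x
  proof -
    have "inner (B x) (B x) = inner x ((B \<circ> B) x)"
      using posB by (simp add: pos_op_def adj_pair_def)
    also have "\<dots> = inner (T' x) (T' x)"
      unfolding BB by (simp add: adj_pairD[OF adj_pair_sym[OF adjT]])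
    finally show ?thesis by (simp add: norm_eq_sqrt_inner)
  qed
  \<comment> \<open>\<open>T* T\<close> commutes with \<open>T T*\<close>, hence with its root \<open>B\<close>; so \<open>B\<close> commutes with the root \<open>A\<close>
    of \<open>T* T\<close>.\<close>
  have AB: "A \<circ> B = B \<circ> A"
  proof -
    have bcT': "bounded_clinear T'" by (rule adj_pair_bounded_clinear[OF assms(1) adjT])
    have blB: "bounded_linear B" using posB by (simp add: pos_op_def)
    have posTT': "pos_op (T \<circ> T')"
      using pos_op_adj_comp[OF _ adj_pair_sym[OF adjT]] bcT' by (simp add: bounded_clinear_def)
    note rB = op_sqrt_is_positive_root[OF bounded_clinear_comp[OF assms(1) bcT'] posTT']
    have "B = op_sqrt (T \<circ> T')" by (rule rB(5)[OF posB BB])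
    moreover have "pos_op (T' \<circ> T)" by (rule pos_op_adj_comp[OF blT adjT])
    note rA = op_sqrt_is_positive_root[OF bounded_clinear_comp[OF bcT' assms(1)] this]
    have "A = op_sqrt (T' \<circ> T)" by (simp add: A_def op_abs_def T'_def)
    have "(T' \<circ> T) \<circ> (T \<circ> T') = (T \<circ> T') \<circ> (T' \<circ> T)"
      using assms(3) by (simp add: binormal_def T'_def)
    then have "(T' \<circ> T) \<circ> B = B \<circ> (T' \<circ> T)"
      unfolding \<open>B = op_sqrt (T \<circ> T')\<close>
      using \<open>pos_op (T' \<circ> T)\<close> by (intro rB(4)) (simp_all add: pos_op_def)
    then show ?thesis
      unfolding \<open>A = op_sqrt (T' \<circ> T)\<close> using rA(4)[OF blB] by simp
  qed
  have A_BmA: "pos_op (A \<circ> (\<lambda>x. B x - A x))"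
  proof (rule pos_op_comp_commute[OF A(2)])
    show "pos_op (\<lambda>x. B x - A x)"
      by (rule pos_op_diff_of_norm_le[OF A(2) posB AB]) (simp add: norm_B A(4) norm_T_le)
    show "A \<circ> (\<lambda>x. B x - A x) = (\<lambda>x. B x - A x) \<circ> A"
      using AB by (auto simp: fun_eq_iff linear_simps[OF blA])
  qed

  define M' where "M' x = (1/2) *\<^sub>R (T' x + W (A x))" for x
  have M: "mean_transform T x = (1/2) *\<^sub>R (T x + A (V x))" for x
    by (simp add: mean_transform_def A_def V_def)
  have bcM: "bounded_clinear (mean_transform T)"
    unfolding bounded_clinear_iff
  proof (intro conjI allI)
    show "bounded_linear (mean_transform T)"
      unfolding M[abs_def]
      by (intro bounded_linear_compose[OF bounded_linear_scaleR_right] bounded_linear_add blT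
          bounded_linear_compose[OF blA blV])
    show "mean_transform T (\<i> *\<^sub>C x) = \<i> *\<^sub>C mean_transform T x" for x
      using assms(1) A(1) V(1)
      by (simp add: M bounded_clinear_iff linear_simps[OF bounded_linear_scaleC_ii])
  qed
  have "adj_pair (mean_transform T) M'"
    by (simp add: adj_pair_def M M'_def inner_add adj_pairD[OF adjT] adj_pairD[OF adjV]
        adj_pairD[OF symA])
  then have op_adj_M: "op_adj (mean_transform T) = M'" by (rule op_adj_eqI[OF bcM])

  have "norm (mean_transform T x) \<le> norm (T x)" for x
  proof -
    have "norm (A (V x)) = norm (T (V x))" by (rule A(4))
    also have "\<dots> \<le> norm (T' (V x))" by (rule norm_T_le)
    also have "T' (V x) = A x" by (simp add: AWV flip: AW)
    finally have "norm (A (V x)) \<le> norm (T x)" by (simp add: A(4))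
    then have "norm (T x + A (V x)) \<le> 2 * norm (T x)"
      using norm_triangle_ineq[of "T x" "A (V x)"] by linarith
    then show ?thesis by (simp add: M)
  qed
  moreover have "norm (T x) \<le> norm (M' x)" for x
  proof -
    have W_AB: "W (A x + B x) = 2 *\<^sub>R M' x"
      by (simp add: M'_def B_def linear_simps[OF blW] WVA flip: AW)
    have "norm (V (W (A x + B x))) \<le> norm (W (A x + B x))" by (rule V(3))
    moreover have "V (W (A x + B x)) = A x + B x"
      by (simp add: B_def linear_simps[OF blW] linear_simps[OF blV] WVA VWA)
    ultimately have "norm (A x + B x) \<le> 2 * norm (M' x)" by (simp add: W_AB)
    moreover have "2 * norm (T x) \<le> norm (A x + B x)"
    proof (rule power2_le_imp_le)
      have "0 \<le> inner (A (B x - A x)) x" using A_BmA by (simp add: pos_op_def)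
      also have "\<dots> = inner (A x) (B x) - inner (A x) (A x)"
        unfolding adj_pairD[OF symA, of "B x - A x"] by (simp add: inner_diff inner_commute)
      finally have "(norm (A x))\<^sup>2 \<le> inner (A x) (B x)" by (simp add: dot_square_norm)
      moreover have "(norm (A x))\<^sup>2 \<le> (norm (B x))\<^sup>2" by (simp add: norm_B A(4) norm_T_le)
      moreover have "(norm (A x + B x))\<^sup>2 = (norm (A x))\<^sup>2 + 2 * inner (A x) (B x) + (norm (B x))\<^sup>2"
        unfolding power2_norm_eq_inner by (simp add: inner_add inner_commute)
      moreover have "(2 * norm (T x))\<^sup>2 = 4 * (norm (A x))\<^sup>2" by (simp add: A(4) power_mult_distrib)
      ultimately show "(2 * norm (T x))\<^sup>2 \<le> (norm (A x + B x))\<^sup>2" by linarith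
    qed simp
    ultimately show ?thesis by simp
  qed
  ultimately have "norm (mean_transform T x) \<le> norm (op_adj (mean_transform T) x)" for x
    unfolding op_adj_M by (rule order_trans)
  then show ?thesis using co_hyponormal_iff_norm_le[OF bcM] by blast
qed

end
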